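(* Let $G$ be a topological group. Then the following are equivalent: (a) the group $G$ has the fixed-point property for cones; (b) the group $G$ has the invariant normalized integral property for $\mathcal{C}^b_{ru}(G)$.
   Context: All vector spaces are real and all locally convex topologies are Hausdorff; $E'$ denotes the topological dual of $E$. **Fixed-point property for cones.** A cone $C$ in a vector space is a non-empty subset closed under addition and under multiplication by non-negative scalars (hence convex); it is proper if $C\cap(-C)=\{0\}$. Let $C$ be a cone in a locally convex vector space $E$. A representation of a topological group $G$ on $C$ is a linear representation $\pi$ of $G$ on $E$ (each $\pi(g)$ continuous, so that the adjoint $\pi^*(g)\lambda=\lambda\circ\pi(g^{-1})$ acts on $E'$) such that $\pi(g)C\subset C$ for all $g\in G$. - It is locally bounded right-uniformly continuous if there is a non-zero $x_0\in C$ whose orbit is a bounded subset of $E$ (absorbed by every neighborhood of the origin) and such that for every neighborhood $U\subset E$ of the origin there is a neighborhood $V\subset G$ of the identity with $\pi(ag)x_0-\pi(g)x_0\in U$ for all $a\in V$, $g\in G$. - It is of cobounded type if there is $\lambda\in E'$ such that for every $\lambda'\in E'$ there are $g_1,\dots,g_n\in G$ with $\pm\lambda'\le\sum_{j=1}^n\pi^*(g_j)\lambda$, where $\mu\le\nu$ in $E'$ means $\mu(c)\le\nu(c)$ for all $c\in C$. $G$ has the fixed-point property for cones if every representation of $G$ on a non-empty weakly complete (i.e. complete for the weak topology $\sigma(E,E')$) proper convex cone $C$ in a locally convex vector space $E$ which is locally bounded right-uniformly continuous and of cobounded type has a non-zero fixed point in $C$. **Invariant normalized integral property.** $\mathcal{C}^b(G)$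 is the space of bounded continuous real functions on $G$ with the supremum norm and pointwise order, and $(gf)(x)=f(g^{-1}x)$ is the left-translation action. $\mathcal{C}^b_{ru}(G)$ is the space of $f\in\mathcal{C}^b(G)$ such that $g\mapsto gf$ is continuous for the supremum norm. For a non-zero $f\in\mathcal{C}^b_{ru}(G)$ with $f\ge 0$, let $\mathcal{C}^b_{ru}(G,f)$ be the set of all $h\in\mathcal{C}^b_{ru}(G)$ such that $|h|\le\sum_{j=1}^n g_jf$ for some $g_1,\dots,g_n\in G$; it is a $G$-invariant linear subspace. An invariant normalized integral on $\mathcal{C}^b_{ru}(G,f)$ is a positive, $G$-invariant linear functional $\mathrm{I}$ on it with $\mathrm{I}(f)=1$. $G$ has the invariant normalized integral property for $\mathcal{C}^b_{ru}(G)$ if $\mathcal{C}^b_{ru}(G,f)$ admits an invariant normalized integral for every non-zero $f\ge 0$ in $\mathcal{C}^b_{ru}(G)$. *)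

theory Defs
  imports "HOL-Analysis.Analysis" "HOL-Library.Function_Algebras"
begin

text \<open>
  Topological groups are the types of class \<open>topological_group_add\<close>. This class assumes neither
  commutativity nor the Hausdorff property; only the notation for the group law is additive, so
  \<open>g + h\<close>, \<open>- g\<close> and \<open>0\<close> are the product, the inverse and the identity.
\<close>

section \<open>Locally convex spaces\<close>

text \<open>
  The vector space is a whole type of class \<open>real_vector\<close>, while its topology is a variable, since
  type classes would attach a single topology to the type.
\<close>

definition locally_convex_space :: "'e::real_vector topology \<Rightarrow> bool" where
  "locally_convex_space T \<longleftrightarrow>
     topspace T = UNIV \<and>
     Hausdorff_space T \<and>
     continuous_map (prod_topology T T) T (\<lambda>(x, y). x + y) \<and>
     continuous_map (prod_topology euclideanreal T) T (\<lambda>(c, x). c *\<^sub>R x) \<and>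
     neighbourhood_base_at 0 convex T"

definition tvs_bounded :: "'e::real_vector topology \<Rightarrow> 'e set \<Rightarrow> bool" where
  "tvs_bounded T B \<longleftrightarrow>
     (\<forall>U. openin T U \<and> 0 \<in> U \<longrightarrow> (\<exists>r>0. \<forall>t. \<bar>t\<bar> \<ge> r \<longrightarrow> B \<subseteq> (\<lambda>x. t *\<^sub>R x) ` U))"

definition continuous_dual :: "'e::real_vector topology \<Rightarrow> ('e \<Rightarrow> real) set" where
  "continuous_dual T = {\<phi>. linear \<phi> \<and> continuous_map T euclideanreal \<phi>}"

definition weak_topology :: "'e::real_vector topology \<Rightarrow> 'e topology" where
  "weak_topology T =
     topology_generated_by {\<phi> -` U |\<phi> U. \<phi> \<in> continuous_dual T \<and> open U}"

text \<open>
  Completeness of a subset for the translation-invariant uniformity of a vector space topology: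
  every proper Cauchy filter on \<open>C\<close> converges to a point of \<open>C\<close>.
\<close>

definition tvs_complete :: "'e::real_vector topology \<Rightarrow> 'e set \<Rightarrow> bool" where
  "tvs_complete T C \<longleftrightarrow>
     (\<forall>F. F \<noteq> bot \<and> F \<le> principal C \<and>
          (\<forall>U. openin T U \<and> 0 \<in> U \<longrightarrow> (\<forall>\<^sub>F (x, y) in F \<times>\<^sub>F F. x - y \<in> U)) \<longrightarrow>
          (\<exists>x\<in>C. limitin T (\<lambda>y. y) x F))"

definition weakly_complete :: "'e::real_vector topology \<Rightarrow> 'e set \<Rightarrow> bool" where
  "weakly_complete T C \<longleftrightarrow> tvs_complete (weak_topology T) C"

section \<open>The fixed-point property for cones\<close>

definition proper_cone :: "'e::real_vector set \<Rightarrow> bool" where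
  "proper_cone C \<longleftrightarrow> convex_cone C \<and> C \<inter> uminus ` C = {0}"

definition cone_representation ::
    "'e::real_vector topology \<Rightarrow> 'e set \<Rightarrow> ('g::topological_group_add \<Rightarrow> 'e \<Rightarrow> 'e) \<Rightarrow> bool" where
  "cone_representation T C \<pi> \<longleftrightarrow>
     (\<forall>g. linear (\<pi> g) \<and> continuous_map T T (\<pi> g) \<and> \<pi> g ` C \<subseteq> C) \<and>
     \<pi> 0 = id \<and>
     (\<forall>g h. \<pi> (g + h) = \<pi> g \<circ> \<pi> h)"

definition adjoint_rep ::
    "('g::topological_group_add \<Rightarrow> 'e \<Rightarrow> 'e) \<Rightarrow> 'g \<Rightarrow> ('e \<Rightarrow> real) \<Rightarrow> 'e \<Rightarrow> real" where
  "adjoint_rep \<pi> g \<phi> = \<phi> \<circ> \<pi> (- g)"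

definition locally_bounded_ruc ::
    "'e::real_vector topology \<Rightarrow> 'e set \<Rightarrow> ('g::topological_group_add \<Rightarrow> 'e \<Rightarrow> 'e) \<Rightarrow> bool" where
  "locally_bounded_ruc T C \<pi> \<longleftrightarrow>
     (\<exists>x\<^sub>0\<in>C. x\<^sub>0 \<noteq> 0 \<and>
        tvs_bounded T (range (\<lambda>g. \<pi> g x\<^sub>0)) \<and>
        (\<forall>U. openin T U \<and> 0 \<in> U \<longrightarrow>
           (\<exists>V. open V \<and> 0 \<in> V \<and> (\<forall>a\<in>V. \<forall>g. \<pi> (a + g) x\<^sub>0 - \<pi> g x\<^sub>0 \<in> U))))"

definition cone_le :: "'e set \<Rightarrow> ('e \<Rightarrow> real) \<Rightarrow> ('e \<Rightarrow> real) \<Rightarrow> bool" where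
  "cone_le C \<mu> \<nu> \<longleftrightarrow> (\<forall>c\<in>C. \<mu> c \<le> \<nu> c)"

definition cobounded_type ::
    "'e::real_vector topology \<Rightarrow> 'e set \<Rightarrow> ('g::topological_group_add \<Rightarrow> 'e \<Rightarrow> 'e) \<Rightarrow> bool" where
  "cobounded_type T C \<pi> \<longleftrightarrow>
     (\<exists>\<phi>\<in>continuous_dual T. \<forall>\<psi>\<in>continuous_dual T. \<exists>(n::nat) (g :: nat \<Rightarrow> 'g).
        cone_le C \<psi> (\<lambda>x. \<Sum>j=1..n. adjoint_rep \<pi> (g j) \<phi> x) \<and>
        cone_le C (\<lambda>x. - \<psi> x) (\<lambda>x. \<Sum>j=1..n. adjoint_rep \<pi> (g j) \<phi> x))"

text \<open>
  A formula cannot quantify over types, so the type \<open>'e\<close> carrying the vector spaces is a parameter.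
\<close>

definition fixed_point_property_for_cones ::
    "'g::topological_group_add itself \<Rightarrow> 'e::real_vector itself \<Rightarrow> bool" where
  "fixed_point_property_for_cones G E \<longleftrightarrow>
     (\<forall>(T :: 'e topology) C (\<pi> :: 'g \<Rightarrow> 'e \<Rightarrow> 'e).
        locally_convex_space T \<and> proper_cone C \<and> weakly_complete T C \<and>
        cone_representation T C \<pi> \<and> locally_bounded_ruc T C \<pi> \<and> cobounded_type T C \<pi> \<longrightarrow>
        (\<exists>x\<in>C. x \<noteq> 0 \<and> (\<forall>g. \<pi> g x = x)))"

section \<open>The invariant normalized integral property\<close>

definition left_translate ::
    "'g::topological_group_add \<Rightarrow> ('g \<Rightarrow>\<^sub>C real) \<Rightarrow> ('g \<Rightarrow>\<^sub>C real)" where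
  "left_translate g f = Bcontfun (\<lambda>x. apply_bcontfun f (- g + x))"

lemma apply_left_translate [simp]:
  "apply_bcontfun (left_translate g f) x = apply_bcontfun f (- g + x)"
proof -
  have "continuous_on UNIV (\<lambda>x. - g + x)"
    by (intro continuous_intros)
  then have "continuous_on UNIV (\<lambda>x. apply_bcontfun f (- g + x))"
    using apply_bcontfun[of f] by (auto simp: bcontfun_def intro: continuous_on_compose2)
  moreover have "bounded (range (\<lambda>x. apply_bcontfun f (- g + x)))"
    using apply_bcontfun[of f] by (auto simp: bcontfun_def intro: bounded_subset)
  ultimately have "(\<lambda>x. apply_bcontfun f (- g + x)) \<in> bcontfun"
    by (simp add: bcontfun_def)
  then show ?thesis
    by (simp add: left_translate_def Bcontfun_inverse)
qed

definition Cb_ru :: "('g::topological_group_add \<Rightarrow>\<^sub>C real) set" where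
  "Cb_ru = {f. continuous_on UNIV (\<lambda>g. left_translate g f)}"

definition nonneg_fun :: "('g::topological_space \<Rightarrow>\<^sub>C real) \<Rightarrow> bool" where
  "nonneg_fun f \<longleftrightarrow> (\<forall>x. 0 \<le> apply_bcontfun f x)"

definition Cb_ru_dominated ::
    "('g::topological_group_add \<Rightarrow>\<^sub>C real) \<Rightarrow> ('g \<Rightarrow>\<^sub>C real) set" where
  "Cb_ru_dominated f =
     {h \<in> Cb_ru. \<exists>(n::nat) (g :: nat \<Rightarrow> 'g).
        \<forall>x. \<bar>apply_bcontfun h x\<bar> \<le> (\<Sum>j=1..n. apply_bcontfun (left_translate (g j) f) x)}"

text \<open>
  The functional is total on the type, but only its values on \<open>Cb_ru_dominated f\<close> are constrained.
\<close>

definition invariant_normalized_integral ::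
    "('g::topological_group_add \<Rightarrow>\<^sub>C real) \<Rightarrow> (('g \<Rightarrow>\<^sub>C real) \<Rightarrow> real) \<Rightarrow> bool" where
  "invariant_normalized_integral f I \<longleftrightarrow>
     (\<forall>h\<in>Cb_ru_dominated f. \<forall>k\<in>Cb_ru_dominated f. I (h + k) = I h + I k) \<and>
     (\<forall>c. \<forall>h\<in>Cb_ru_dominated f. I (c *\<^sub>R h) = c * I h) \<and>
     (\<forall>h\<in>Cb_ru_dominated f. nonneg_fun h \<longrightarrow> 0 \<le> I h) \<and>
     (\<forall>g. \<forall>h\<in>Cb_ru_dominated f. I (left_translate g h) = I h) \<and>
     I f = 1"

definition invariant_normalized_integral_property ::
    "'g::topological_group_add itself \<Rightarrow> bool" where
  "invariant_normalized_integral_property G \<longleftrightarrow>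
     (\<forall>f :: 'g \<Rightarrow>\<^sub>C real. f \<in> Cb_ru \<and> f \<noteq> 0 \<and> nonneg_fun f \<longrightarrow>
        (\<exists>I. invariant_normalized_integral f I))"

section \<open>Pointwise vector space structure on functions\<close>

text \<open>
  It makes \<open>('g \<Rightarrow>\<^sub>C real) \<Rightarrow> real\<close> a real vector space, which contains a copy of the algebraic dual
  of each \<open>Cb_ru_dominated f\<close>.
\<close>

instantiation "fun" :: (type, real_vector) real_vector
begin

definition scaleR_fun :: "real \<Rightarrow> ('a \<Rightarrow> 'b) \<Rightarrow> 'a \<Rightarrow> 'b" where
  "scaleR_fun c f = (\<lambda>x. c *\<^sub>R f x)"

instance
  by standard (auto simp: scaleR_fun_def fun_eq_iff scaleR_add_right scaleR_add_left)

end

end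

theory Submission
  imports Defs
begin

text \<open>
  An invariant integral turns a representation with a good orbit into a fixed point: pairing
  \<open>\<phi> \<in> E'\<close> with the orbit of \<open>x\<^sub>0\<close> gives a function in \<open>Cb_ru_dominated f\<close>, where \<open>f\<close> comes from the
  cobounding functional, so integrating yields a positive invariant functional \<open>\<Lambda>\<close> on \<open>E'\<close>. By
  Hahn--Banach \<open>\<Lambda>\<close> is a weak limit of evaluations at points of the cone, hence by weak completeness
  it is evaluation at a point, and this point is fixed. Conversely, the positive functionals on
  \<open>Cb_ru_dominated f\<close> form a weakly complete cone for the topology of pointwise convergence, the
  orbit of a point evaluation is bounded and right-uniformly continuous, and evaluation at \<open>f\<close> is
  cobounding; a fixed point is an invariant integral up to normalisation.
\<close>

section \<open>The Hahn--Banach theorem\<close>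

text \<open>A weakly complete cone offers no compactness, so nothing is averaged inside it: the
  scalar functions \<open>g \<mapsto> \<phi> (\<pi> g x\<^sub>0)\<close> are averaged instead.
  Boundedness and uniform continuity of the orbit put them in \<open>Cb_ru\<close>, and
  coboundedness puts all of them in one and the same dominated subspace, so that a single integral
  handles every \<open>\<phi>\<close>. Its normalisation keeps the resulting point away from
  \<open>0\<close>. In the converse direction, domination by translates of \<open>f\<close> does
  three jobs: it makes the cone of positive functionals proper, makes evaluation at \<open>f\<close>
  cobounding, and forces an invariant positive functional that vanishes at \<open>f\<close> to
  vanish altogether, so that a non-zero fixed point can be normalised. Hahn--Banach is stated for
  sublinear functions because it is applied to two of them that need not be seminorms: the gauge of
  a convex neighbourhood, which makes continuous functionals separate points, and the distance from
  a cone.\<close>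

definition sublinear :: "('v::real_vector \<Rightarrow> real) \<Rightarrow> bool" where
  "sublinear p \<longleftrightarrow> (\<forall>x y. p (x + y) \<le> p x + p y) \<and> (\<forall>c x. 0 \<le> c \<longrightarrow> p (c *\<^sub>R x) = c * p x)"

lemma sublinear_add: "sublinear p \<Longrightarrow> p (x + y) \<le> p x + p y"
  and sublinear_scale: "sublinear p \<Longrightarrow> 0 \<le> c \<Longrightarrow> p (c *\<^sub>R x) = c * p x"
  by (auto simp: sublinear_def)

lemma sublinear_zero: "sublinear p \<Longrightarrow> p 0 = 0"
  using sublinear_scale[of p 0 0] by simp

lemma sublinear_ge_uminus: "sublinear p \<Longrightarrow> - p (- x) \<le> p x"
  using sublinear_add[of p x "- x"] sublinear_zero[of p] by simp

text \<open>Scaling back by \<open>inverse c\<close> turns the one-sided estimate into an equality.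
  An upper estimate is what comes naturally when \<open>p\<close> is an infimum.\<close>

lemma sublinearI:
  assumes add: "\<And>x y. p (x + y) \<le> p x + p y"
    and scale: "\<And>c x. 0 < c \<Longrightarrow> p (c *\<^sub>R x) \<le> c * p x"
    and zero: "p 0 = 0"
  shows "sublinear p"
  unfolding sublinear_def
proof (intro conjI allI impI)
  fix c x assume c: "0 \<le> (c::real)"
  show "p (c *\<^sub>R x) = c * p x"
  proof (cases "c = 0")
    case False
    with c have pos: "c > 0" by simp
    have "p (inverse c *\<^sub>R (c *\<^sub>R x)) \<le> inverse c * p (c *\<^sub>R x)"
      using pos by (intro scale) auto
    then have "p x \<le> p (c *\<^sub>R x) / c"
      using pos by (simp add: field_simps)
    then have "c * p x \<le> p (c *\<^sub>R x)"
      using pos by (simp add: field_simps)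
    with scale[OF pos, of x] show ?thesis by simp
  qed (simp add: zero)
qed (rule add)

text \<open>Meant for subadditivity of functions given by infima: competitors for the two summands
  combine into one for the sum.\<close>

lemma le_cINF_add:
  fixes f :: "'a \<Rightarrow> real" and h :: "'b \<Rightarrow> real"
  assumes "A \<noteq> {}" "B \<noteq> {}" "\<And>a b. a \<in> A \<Longrightarrow> b \<in> B \<Longrightarrow> c \<le> f a + h b"
  shows "c \<le> (INF a\<in>A. f a) + (INF b\<in>B. h b)"
proof -
  have "c - f a \<le> (INF b\<in>B. h b)" if "a \<in> A" for a
    using assms that by (intro cINF_greatest) (auto simp: algebra_simps)
  then have "c - (INF b\<in>B. h b) \<le> (INF a\<in>A. f a)"
    using assms by (intro cINF_greatest) (auto simp: algebra_simps)
  then show ?thesis by simp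
qed

lemma le_mult_cINF:
  fixes f :: "'a \<Rightarrow> real"
  assumes "A \<noteq> {}" "0 < c" "\<And>a. a \<in> A \<Longrightarrow> r \<le> c * f a"
  shows "r \<le> c * (INF a\<in>A. f a)"
proof -
  have "r / c \<le> (INF a\<in>A. f a)"
    using assms by (intro cINF_greatest) (auto simp: field_simps)
  then show ?thesis using \<open>0 < c\<close> by (simp add: field_simps)
qed

text \<open>The infimum over \<open>t \<ge> 0\<close> of
  \<open>p (x + t *\<^sub>R y) - t * p y\<close> lowers \<open>p\<close> along the ray of
  \<open>y\<close>. It stays above \<open>- p (- x)\<close> because
  \<open>p (t *\<^sub>R y) = t * p y\<close>. The parameter \<open>t = 0\<close> gives
  \<open>q \<le> p\<close>, and \<open>t = 1\<close> at the point \<open>- y\<close> gives the last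
  claim.\<close>

lemma sublinear_reduce:
  assumes p: "sublinear p"
  obtains q where "sublinear q" "q \<le> p" "q (- y) \<le> - p y"
proof
  define A where "A = (\<lambda>x t. p (x + t *\<^sub>R y) - t * p y)"
  define q where "q = (\<lambda>x. INF t\<in>{0..}. A x t)"
  have bdd: "bdd_below (A x ` {0..})" for x
  proof (rule bdd_belowI)
    fix a assume "a \<in> A x ` {0..}"
    then obtain t where t: "t \<ge> 0" "a = A x t" by auto
    have "t * p y = p ((x + t *\<^sub>R y) + (- x))"
      using sublinear_scale[OF p t(1)] by simp
    also have "\<dots> \<le> p (x + t *\<^sub>R y) + p (- x)"
      by (rule sublinear_add[OF p])
    finally show "- p (- x) \<le> a"
      by (simp add: t A_def)
  qed
  have q_le: "q x \<le> A x t" if "t \<ge> 0" for x t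
    unfolding q_def using that by (intro cINF_lower bdd) auto
  show "sublinear q"
  proof (rule sublinearI)
    fix x z
    show "q (x + z) \<le> q x + q z"
      unfolding q_def[THEN fun_cong, of x] q_def[THEN fun_cong, of z]
    proof (rule le_cINF_add)
      fix s t :: real assume st: "s \<in> {0..}" "t \<in> {0..}"
      have "q (x + z) \<le> A (x + z) (s + t)"
        using st by (intro q_le) auto
      also have "\<dots> \<le> A x s + A z t"
        using sublinear_add[OF p, of "x + s *\<^sub>R y" "z + t *\<^sub>R y"]
        by (simp add: A_def algebra_simps)
      finally show "q (x + z) \<le> A x s + A z t" .
    qed auto
  next
    fix c :: real and x assume c: "0 < c"
    show "q (c *\<^sub>R x) \<le> c * q x"
      unfolding q_def[THEN fun_cong, of x]
    proof (rule le_mult_cINF)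
      fix t :: real assume t: "t \<in> {0..}"
      have "q (c *\<^sub>R x) \<le> A (c *\<^sub>R x) (c * t)"
        using c t by (intro q_le) auto
      also have "\<dots> = c * A x t"
        using sublinear_scale[OF p, of c "x + t *\<^sub>R y"] c by (simp add: A_def algebra_simps)
      finally show "q (c *\<^sub>R x) \<le> c * A x t" .
    qed (use c in auto)
  next
    have "A 0 t = 0" if "t \<in> {0..}" for t
      using that sublinear_scale[OF p, of t y] by (simp add: A_def)
    then show "q 0 = 0"
      by (simp add: q_def)
  qed
  show "q \<le> p"
    using q_le[of 0] by (auto simp: le_fun_def A_def)
  show "q (- y) \<le> - p y"
    using q_le[of 1 "- y"] by (simp add: A_def sublinear_zero[OF p])
qed

text \<open>\<open>sublinear_reduce\<close> cannot lower a minimal \<open>p\<close>, so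
  \<open>p\<close> is odd, and oddness turns subadditivity into additivity.\<close>

lemma minimal_sublinear_linear:
  assumes p: "sublinear p" and min: "\<And>q. sublinear q \<Longrightarrow> q \<le> p \<Longrightarrow> q = p"
  shows "linear p"
proof -
  have neg: "p (- y) = - p y" for y
  proof -
    obtain q where "sublinear q" "q \<le> p" "q (- y) \<le> - p y"
      by (rule sublinear_reduce[OF p])
    with min have "p (- y) \<le> - p y" by blast
    with sublinear_ge_uminus[OF p, of "- y"] show ?thesis by simp
  qed
  show ?thesis
  proof (rule linearI)
    fix x y
    have "p x \<le> p (x + y) + p (- y)"
      using sublinear_add[OF p, of "x + y" "- y"] by simp
    with sublinear_add[OF p, of x y] neg[of y] show "p (x + y) = p x + p y" by simp
  next
    fix c x
    show "p (c *\<^sub>R x) = c *\<^sub>R p x"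
    proof (cases "c \<ge> 0")
      case False
      then show ?thesis
        using sublinear_scale[OF p, of "- c" x] neg[of "c *\<^sub>R x"] by simp
    qed (simp add: sublinear_scale[OF p])
  qed
qed

theorem Hahn_Banach_sublinear:
  fixes p :: "'v::real_vector \<Rightarrow> real"
  assumes p: "sublinear p"
  obtains l where "linear l" "l \<le> p" "l x = p x"
proof -
  \<comment> \<open>Searching below \<open>r\<close> instead of \<open>p\<close> fixes the value at
    \<open>x\<close>: a linear \<open>l \<le> r\<close> has \<open>l (- x) \<le> - p x\<close>, that
    is \<open>p x \<le> l x\<close>.\<close>
  obtain r where r: "sublinear r" "r \<le> p" "r (- x) \<le> - p x"
    by (rule sublinear_reduce[OF p])
  define S where "S = {q. sublinear q \<and> q \<le> r}"
  have "\<exists>m\<in>S. \<forall>a\<in>S. m \<ge> a \<longrightarrow> a = m"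
  proof (rule predicate_Zorn)
    show "partial_order_on S (relation_of (\<ge>) S)"
      by (rule partial_order_on_relation_ofI) auto
  next
    fix K assume K: "K \<in> Chains (relation_of (\<ge>) S)"
    then have KS: "q \<in> S" if "q \<in> K" for q
      using that by (auto simp: Chains_def relation_of_def)
    show "\<exists>u\<in>S. \<forall>a\<in>K. a \<ge> u"
    proof (cases "K = {}")
      case True
      then show ?thesis using r by (auto simp: S_def)
    next
      case False
      define u where "u = (\<lambda>x. INF q\<in>K. q x)"
      \<comment> \<open>Every \<open>q\<close> in the chain satisfies
        \<open>q x \<ge> - q (- x) \<ge> - r (- x)\<close>, a bound independent of
        \<open>q\<close>.\<close>
      have bdd: "bdd_below ((\<lambda>q. q x) ` K)" for x
      proof (rule bdd_belowI)
        fix a assume "a \<in> (\<lambda>q. q x) ` K"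
        then obtain q where q: "q \<in> K" "a = q x" by auto
        with KS[OF q(1)] show "- r (- x) \<le> a"
          using sublinear_ge_uminus[of q x] by (force simp: S_def le_fun_def dest: spec[of _ "- x"])
      qed
      have u_le: "u x \<le> q x" if "q \<in> K" for q x
        unfolding u_def using that by (intro cINF_lower bdd)
      have "sublinear u"
      proof (rule sublinearI)
        fix x y
        show "u (x + y) \<le> u x + u y"
          unfolding u_def[THEN fun_cong, of x] u_def[THEN fun_cong, of y]
        proof (rule le_cINF_add)
          fix q1 q2 assume q: "q1 \<in> K" "q2 \<in> K"
          \<comment> \<open>The two infima are tested with different members of the chain; the
            smaller member serves for both.\<close>
          then have "q1 \<le> q2 \<or> q2 \<le> q1"
            using K by (auto simp: Chains_def relation_of_def)
          moreover have "u (x + y) \<le> q1 x + q1 y" "u (x + y) \<le> q2 x + q2 y"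
            using u_le q KS sublinear_add order_trans unfolding S_def by blast+
          ultimately show "u (x + y) \<le> q1 x + q2 y"
            by (auto simp: le_fun_def) (smt (verit))+
        qed (use False in auto)
      next
        fix c :: real and x assume c: "0 < c"
        show "u (c *\<^sub>R x) \<le> c * u x"
          unfolding u_def[THEN fun_cong, of x]
        proof (rule le_mult_cINF)
          fix q assume q: "q \<in> K"
          show "u (c *\<^sub>R x) \<le> c * q x"
            using u_le[OF q, of "c *\<^sub>R x"] KS[OF q] sublinear_scale[of q c x] c by (simp add: S_def)
        qed (use c False in auto)
      next
        have "q 0 = 0" if "q \<in> K" for q
          using KS[OF that] by (simp add: S_def sublinear_zero)
        then have "u 0 = (INF q\<in>K. 0)"
          unfolding u_def by (intro INF_cong) auto
        then show "u 0 = 0"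
          using False by simp
      qed
      moreover have "u \<le> r"
        using False KS u_le unfolding S_def le_fun_def by (blast intro: order_trans)
      ultimately show ?thesis
        using u_le by (auto simp: S_def le_fun_def)
    qed
  qed
  then obtain l where l: "l \<in> S" "\<And>a. a \<in> S \<Longrightarrow> l \<ge> a \<Longrightarrow> a = l"
    by blast
  have "linear l"
    using l by (intro minimal_sublinear_linear) (auto simp: S_def intro: order_trans)
  moreover have lr: "l \<le> r" using l by (simp add: S_def)
  then have "l \<le> p" using r by simp
  moreover have "l x = p x"
  proof (rule antisym)
    have "l (- x) \<le> - p x"
      using lr r(3) by (meson le_funD order_trans)
    then show "p x \<le> l x"
      using linear_neg[OF \<open>linear l\<close>, of x] by simp
  qed (use \<open>l \<le> p\<close> in \<open>simp add: le_fun_def\<close>)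
  ultimately show thesis by (rule that)
qed

section \<open>The dual of a locally convex space\<close>

lemma subspace_continuous_dual: "subspace (continuous_dual T)"
proof -
  have "linear (\<lambda>_. 0 :: real)"
    by (rule linearI) auto
  moreover have "linear (\<lambda>x. \<phi> x + \<psi> x)" if "linear \<phi>" "linear \<psi>" for \<phi> \<psi> :: "'a \<Rightarrow> real"
    using that by (intro linear_compose_add)
  moreover have "linear (\<lambda>x. c * \<phi> x)" if "linear \<phi>" for \<phi> :: "'a \<Rightarrow> real" and c
    using linear_compose_scale_right[OF that, of c] by simp
  ultimately show ?thesis
    unfolding subspace_def continuous_dual_def
    by (auto simp: zero_fun_def plus_fun_def scaleR_fun_def
        intro!: continuous_map_add continuous_map_real_mult)
qed

lemma sum_fun_eval: "(\<Sum>i\<in>A. f i) x = (\<Sum>i\<in>A. f i x)"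
  for f :: "'i \<Rightarrow> 'a \<Rightarrow> 'b::comm_monoid_add"
  by (induction A rule: infinite_finite_induct) auto

lemma locally_convex_space_affine:
  assumes "locally_convex_space T"
  shows "continuous_map T T (\<lambda>z. c *\<^sub>R z + b)"
proof -
  have add: "continuous_map (prod_topology T T) T (\<lambda>(x, y). x + y)"
    and scale: "continuous_map (prod_topology euclideanreal T) T (\<lambda>(c, x). c *\<^sub>R x)"
    and [simp]: "topspace T = UNIV"
    using assms by (auto simp: locally_convex_space_def)
  have "continuous_map T (prod_topology euclideanreal T) (\<lambda>z. (c, z))"
    by (intro continuous_map_pairedI) auto
  from continuous_map_compose[OF this scale] have "continuous_map T T (\<lambda>z. c *\<^sub>R z)"
    by (simp add: o_def)
  then have "continuous_map T (prod_topology T T) (\<lambda>z. (c *\<^sub>R z, b))"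
    by (intro continuous_map_pairedI) auto
  from continuous_map_compose[OF this add] show ?thesis
    by (simp add: o_def)
qed

text \<open>A bound from one side is enough, without symmetry of \<open>W\<close>: it is applied to
  \<open>z - y\<close> scaled by \<open>2 / e\<close> and by \<open>- 2 / e\<close>. The factor 2
  yields \<open>e / 2\<close> and hence a strict inequality.\<close>

lemma linear_continuous_if_le_one:
  fixes l :: "'e::real_vector \<Rightarrow> real"
  assumes T: "locally_convex_space T" and l: "linear l"
    and W: "openin T W" "0 \<in> W" "\<And>w. w \<in> W \<Longrightarrow> l w \<le> 1"
  shows "l \<in> continuous_dual T"
proof -
  have top: "topspace T = UNIV" using T by (simp add: locally_convex_space_def)
  have "openin T (l -` S)" if S: "open S" for S
  proof (subst openin_subopen, intro ballI)
    fix y assume "y \<in> l -` S"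
    then obtain e where e: "e > 0" "\<And>z. \<bar>z - l y\<bar> < e \<Longrightarrow> z \<in> S"
      using S by (auto simp: open_dist dist_real_def)
    define a where "a = (\<lambda>c z. c *\<^sub>R z + (- c) *\<^sub>R y)"
    define N where "N = a (2 / e) -` W \<inter> a (- 2 / e) -` W"
    have "openin T (a c -` W)" for c
      using openin_continuous_map_preimage[OF locally_convex_space_affine[OF T] W(1), of c "(- c) *\<^sub>R y"]
      by (simp add: a_def top vimage_def)
    then have "openin T N" by (simp add: N_def openin_Int)
    moreover have "y \<in> N" using W(2) by (simp add: N_def a_def)
    moreover have "N \<subseteq> l -` S"
    proof
      fix z assume "z \<in> N"
      then have "l (a (2 / e) z) \<le> 1" "l (a (- 2 / e) z) \<le> 1"
        using W(3) by (auto simp: N_def)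
      moreover have "l (a c z) = c * (l z - l y)" for c
        unfolding a_def linear_add[OF l] linear_cmul[OF l] by (simp add: algebra_simps)
      ultimately have "\<bar>l z - l y\<bar> < e"
        using e(1) by (auto simp: field_simps abs_less_iff)
      then show "z \<in> l -` S" using e(2) by simp
    qed
    ultimately show "\<exists>N. openin T N \<and> y \<in> N \<and> N \<subseteq> l -` S" by blast
  qed
  then show ?thesis
    using l by (auto simp: continuous_dual_def continuous_map_def top vimage_def)
qed

theorem continuous_dual_separates:
  fixes x :: "'e::real_vector"
  assumes T: "locally_convex_space T" and x: "x \<noteq> 0"
  obtains \<phi> where "\<phi> \<in> continuous_dual T" "\<phi> x \<noteq> 0"
proof -
  have top: "topspace T = UNIV" and "Hausdorff_space T"
    and conv: "neighbourhood_base_at 0 convex T"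
    using T by (auto simp: locally_convex_space_def)
  then obtain U where U: "openin T U" "0 \<in> U" "x \<notin> U"
    using x unfolding Hausdorff_space_def disjnt_iff by (metis UNIV_I)
  from conv[unfolded neighbourhood_base_at_def, rule_format, OF conjI[OF U(1,2)]]
  obtain W V where WV: "openin T W" "convex V" "0 \<in> W" "W \<subseteq> V" "V \<subseteq> U"
    by auto
  then have V0: "0 \<in> V" by blast
  \<comment> \<open>\<open>p\<close> is the Minkowski gauge of \<open>V\<close>. Since
    \<open>V\<close> need not be symmetric, it is merely sublinear. It is at most 1 on
    \<open>W\<close>, which gives continuity of a functional below it, and at least 1 at
    \<open>x\<close>, which lies outside \<open>V\<close>.\<close>
  define A where "A = (\<lambda>v. {t. 0 < t \<and> inverse t *\<^sub>R v \<in> V})"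
  define p where "p = (\<lambda>v. INF t\<in>A v. t)"
  have nonempty: "A v \<noteq> {}" for v
  proof -
    have scale: "continuous_map (prod_topology euclideanreal T) T (\<lambda>(c, x). c *\<^sub>R x)"
      using T by (auto simp: locally_convex_space_def)
    have "continuous_map euclideanreal (prod_topology euclideanreal T) (\<lambda>c. (c, v))"
      by (intro continuous_map_pairedI) (auto simp: top)
    from continuous_map_compose[OF this scale]
    have "open {c. c *\<^sub>R v \<in> W}"
      using WV(1) by (auto simp: o_def continuous_map_def)
    moreover have "0 \<in> {c. c *\<^sub>R v \<in> W}" using WV by simp
    ultimately have "\<exists>e>0. \<forall>c. dist c 0 < e \<longrightarrow> c \<in> {c. c *\<^sub>R v \<in> W}"
      unfolding open_dist by blast
    then obtain e where e: "e > 0" "\<And>c. \<bar>c\<bar> < e \<Longrightarrow> c *\<^sub>R v \<in> W"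
      by auto
    have "inverse (2 / e) *\<^sub>R v \<in> V"
      using e(1) WV(4) e(2)[of "e / 2"] by auto
    then show ?thesis using e(1) by (auto simp: A_def intro!: exI[of _ "2 / e"])
  qed
  have bdd: "bdd_below (A v)" for v
    by (rule bdd_belowI[of _ 0]) (simp add: A_def)
  have p_le: "p v \<le> t" if "t \<in> A v" for v t
    using cINF_lower[of "\<lambda>t. t" "A v" t] bdd that by (simp add: p_def)
  have p_nonneg: "0 \<le> p v" for v
    unfolding p_def using nonempty by (intro cINF_greatest) (auto simp: A_def)
  have "sublinear p"
  proof (rule sublinearI)
    fix y z
    show "p (y + z) \<le> p y + p z"
      unfolding p_def[THEN fun_cong, of y] p_def[THEN fun_cong, of z]
    proof (rule le_cINF_add)
      fix s t assume st: "s \<in> A y" "t \<in> A z"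
      have "(s / (s + t)) *\<^sub>R (inverse s *\<^sub>R y) + (t / (s + t)) *\<^sub>R (inverse t *\<^sub>R z) \<in> V"
        using st by (intro convexD[OF WV(2)]) (auto simp: A_def add_divide_distrib[symmetric])
      also have "(s / (s + t)) *\<^sub>R (inverse s *\<^sub>R y) + (t / (s + t)) *\<^sub>R (inverse t *\<^sub>R z)
          = inverse (s + t) *\<^sub>R (y + z)"
        using st by (simp add: A_def divide_simps scaleR_add_right)
      finally have "s + t \<in> A (y + z)" using st by (simp add: A_def)
      then show "p (y + z) \<le> s + t" by (rule p_le)
    qed (use nonempty in auto)
  next
    fix c :: real and v assume c: "0 < c"
    show "p (c *\<^sub>R v) \<le> c * p v"
      unfolding p_def[THEN fun_cong, of v]
    proof (rule le_mult_cINF)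
      fix t assume t: "t \<in> A v"
      have "inverse (c * t) * c = inverse t" using c by (simp add: field_simps)
      then have "c * t \<in> A (c *\<^sub>R v)" using t c by (simp add: A_def del: inverse_mult_distrib)
      then show "p (c *\<^sub>R v) \<le> c * t" by (rule p_le)
    qed (use nonempty c in auto)
  next
    have "p 0 \<le> 0 + e" if "e > 0" for e
      using that V0 by (intro p_le) (simp add: A_def)
    then have "p 0 \<le> 0" by (rule field_le_epsilon)
    then show "p 0 = 0" using p_nonneg[of 0] by simp
  qed
  then obtain l where l: "linear l" "l \<le> p" "l x = p x"
    by (rule Hahn_Banach_sublinear)
  have "l \<in> continuous_dual T"
  proof (rule linear_continuous_if_le_one[OF T l(1) WV(1,3)])
    fix w assume "w \<in> W"
    then have "1 \<in> A w" using WV(4) by (auto simp: A_def)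
    then show "l w \<le> 1" using p_le l(2) by (meson le_funD order_trans)
  qed
  moreover have "1 \<le> p x"
    unfolding p_def
  proof (rule cINF_greatest)
    fix t assume t: "t \<in> A x"
    show "1 \<le> t"
    proof (rule ccontr)
      assume "\<not> 1 \<le> t"
      then have "t *\<^sub>R (inverse t *\<^sub>R x) + (1 - t) *\<^sub>R 0 \<in> V"
        using t V0 by (intro convexD[OF WV(2)]) (auto simp: A_def)
      then have "x \<in> V" using t by (simp add: A_def)
      then show False using U(3) WV(5) by blast
    qed
  qed (rule nonempty)
  ultimately show thesis using l(3) that by fastforce
qed

section \<open>Weak completeness\<close>

lemma linear_sum_scaleR:
  assumes "subspace D" "finite F" "F \<subseteq> D"
    and "\<And>\<phi> \<psi>. \<phi> \<in> D \<Longrightarrow> \<psi> \<in> D \<Longrightarrow> \<Lambda> (\<phi> + \<psi>) = \<Lambda> \<phi> + \<Lambda> \<psi>"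
    and "\<And>c \<phi>. \<phi> \<in> D \<Longrightarrow> \<Lambda> (c *\<^sub>R \<phi>) = c * (\<Lambda> \<phi> :: real)"
  shows "(\<Sum>\<phi>\<in>F. a \<phi> *\<^sub>R \<phi>) \<in> D \<and> \<Lambda> (\<Sum>\<phi>\<in>F. a \<phi> *\<^sub>R \<phi>) = (\<Sum>\<phi>\<in>F. a \<phi> * \<Lambda> \<phi>)"
  using assms(2,3)
proof (induction F rule: finite_induct)
  case empty
  show ?case using assms(5)[of 0 0] subspace_0[OF assms(1)] by simp
next
  case (insert \<phi> F)
  then have "a \<phi> *\<^sub>R \<phi> \<in> D" and IH: "(\<Sum>\<phi>\<in>F. a \<phi> *\<^sub>R \<phi>) \<in> D"
      "\<Lambda> (\<Sum>\<phi>\<in>F. a \<phi> *\<^sub>R \<phi>) = (\<Sum>\<phi>\<in>F. a \<phi> * \<Lambda> \<phi>)"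
    using assms(1) by (auto intro: subspace_scale)
  then show ?case
    using insert assms(4)[of "a \<phi> *\<^sub>R \<phi>"] assms(5)[of \<phi>] subspace_add[OF assms(1)] by simp
qed

text \<open>If no such point existed, Hahn--Banach, applied to the distance from the evaluations at points
  of \<open>C\<close>, would yield a combination of \<open>F\<close> that is non-negative on \<open>C\<close> while \<open>\<Lambda>\<close> is negative on it.\<close>

lemma positive_functional_approximation:
  fixes C :: "'e::real_vector set" and \<Lambda> :: "('e \<Rightarrow> real) \<Rightarrow> real"
  assumes C: "convex_cone C" and D: "subspace D" "\<And>\<phi>. \<phi> \<in> D \<Longrightarrow> linear \<phi>"
    and add: "\<And>\<phi> \<psi>. \<phi> \<in> D \<Longrightarrow> \<psi> \<in> D \<Longrightarrow> \<Lambda> (\<phi> + \<psi>) = \<Lambda> \<phi> + \<Lambda> \<psi>"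
    and scale: "\<And>c \<phi>. \<phi> \<in> D \<Longrightarrow> \<Lambda> (c *\<^sub>R \<phi>) = c * \<Lambda> \<phi>"
    and pos: "\<And>\<phi>. \<phi> \<in> D \<Longrightarrow> (\<And>x. x \<in> C \<Longrightarrow> 0 \<le> \<phi> x) \<Longrightarrow> 0 \<le> \<Lambda> \<phi>"
    and F: "finite F" "F \<subseteq> D" and e: "0 < (e :: real)"
  obtains x where "x \<in> C" "\<And>\<phi>. \<phi> \<in> F \<Longrightarrow> \<bar>\<phi> x - \<Lambda> \<phi>\<bar> < e"
proof -
  have C0: "0 \<in> C" and Cadd: "\<And>x y. x \<in> C \<Longrightarrow> y \<in> C \<Longrightarrow> x + y \<in> C"
    and Cscale: "\<And>c x. x \<in> C \<Longrightarrow> 0 \<le> c \<Longrightarrow> c *\<^sub>R x \<in> C"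
    using C by (auto simp: convex_cone_iff)
  have lin: "linear \<phi>" if "\<phi> \<in> F" for \<phi> using that F D by blast
  \<comment> \<open>\<open>q v\<close> is the distance, in the sum norm over the coordinates in
    \<open>F\<close>, from \<open>v\<close> to the cone of evaluations at points of
    \<open>C\<close>. Closure of \<open>C\<close> under sums and non-negative multiples makes it
    sublinear.\<close>
  define d where "d = (\<lambda>(v :: ('e \<Rightarrow> real) \<Rightarrow> real) x. \<Sum>\<phi>\<in>F. \<bar>v \<phi> - \<phi> x\<bar>)"
  define q where "q = (\<lambda>v. INF x\<in>C. d v x)"
  have d_nonneg: "0 \<le> d v x" for v x by (simp add: d_def sum_nonneg)
  have ne: "C \<noteq> {}" using C0 by blast
  have q_le: "q v \<le> d v x" if "x \<in> C" for v x
    unfolding q_def using that d_nonneg by (intro cINF_lower bdd_belowI[of _ 0]) auto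
  have q_nonneg: "0 \<le> q v" for v
    unfolding q_def using d_nonneg ne by (intro cINF_greatest) auto
  have q_eq_0: "q v = 0" if "x \<in> C" "\<And>\<phi>. \<phi> \<in> F \<Longrightarrow> v \<phi> = \<phi> x" for v x
    using q_le[OF that(1), of v] q_nonneg[of v] that(2) by (simp add: d_def)
  have "sublinear q"
  proof (rule sublinearI)
    fix v w
    show "q (v + w) \<le> q v + q w"
      unfolding q_def[THEN fun_cong, of v] q_def[THEN fun_cong, of w]
    proof (rule le_cINF_add)
      fix x y assume xy: "x \<in> C" "y \<in> C"
      have "q (v + w) \<le> d (v + w) (x + y)"
        using xy by (intro q_le Cadd)
      also have "\<dots> \<le> (\<Sum>\<phi>\<in>F. \<bar>v \<phi> - \<phi> x\<bar> + \<bar>w \<phi> - \<phi> y\<bar>)"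
        unfolding d_def by (intro sum_mono) (auto simp: linear_add[OF lin])
      finally show "q (v + w) \<le> d v x + d w y"
        by (simp add: d_def sum.distrib)
    qed (use ne in auto)
  next
    fix c :: real and v assume c: "0 < c"
    show "q (c *\<^sub>R v) \<le> c * q v"
      unfolding q_def[THEN fun_cong, of v]
    proof (rule le_mult_cINF)
      fix x assume x: "x \<in> C"
      have "q (c *\<^sub>R v) \<le> d (c *\<^sub>R v) (c *\<^sub>R x)"
        using x c by (intro q_le Cscale) auto
      also have "\<dots> = (\<Sum>\<phi>\<in>F. c * \<bar>v \<phi> - \<phi> x\<bar>)"
        unfolding d_def using c
        by (intro sum.cong)
          (auto simp: linear_cmul[OF lin] scaleR_fun_def abs_mult right_diff_distrib[symmetric])
      finally show "q (c *\<^sub>R v) \<le> c * d v x"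
        by (simp add: d_def sum_distrib_left)
    qed (use ne c in auto)
  next
    show "q 0 = 0"
      using C0 by (rule q_eq_0) (simp add: linear_0[OF lin])
  qed
  then obtain l where l: "linear l" "l \<le> q" "l \<Lambda> = q \<Lambda>"
    by (rule Hahn_Banach_sublinear)
  \<comment> \<open>\<open>q\<close> sees only the coordinates in \<open>F\<close>. So
    \<open>l\<close>, being below \<open>q\<close>, vanishes on every \<open>w\<close> that is zero
    on \<open>F\<close>, and is determined by its values on the indicator functions of the members
    of \<open>F\<close>.\<close>
  define a where "a = (\<lambda>\<phi>. l (\<lambda>\<psi>. if \<psi> = \<phi> then 1 else 0))"
  have l_eq: "l v = (\<Sum>\<phi>\<in>F. a \<phi> * v \<phi>)" for v
  proof -
    define w where "w = v - (\<Sum>\<phi>\<in>F. v \<phi> *\<^sub>R (\<lambda>\<psi>. if \<psi> = \<phi> then 1 else 0))"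
    have "w \<psi> = 0" if "\<psi> \<in> F" for \<psi>
      using that F(1) by (simp add: w_def sum_fun_eval scaleR_fun_def if_distrib cong: if_cong)
    then have "q w = 0" "q (- w) = 0"
      by (auto intro!: q_eq_0[OF C0] simp: linear_0[OF lin])
    then have "l w \<le> 0" "l (- w) \<le> 0"
      using l(2) by (metis le_funD)+
    then have "l w = 0" using linear_neg[OF l(1), of w] by simp
    then show ?thesis
      unfolding w_def linear_diff[OF l(1)] linear_sum[OF l(1)] linear_cmul[OF l(1)]
      by (simp add: a_def mult.commute)
  qed
  \<comment> \<open>On evaluations at points of \<open>C\<close> the distance is 0, so
    \<open>l\<close> is non-positive there. The sign change produces a functional to which
    \<open>pos\<close> applies, and \<open>\<Lambda> \<psi> = - q \<Lambda>\<close> then gives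
    \<open>q \<Lambda> \<le> 0\<close>.\<close>
  define \<psi> where "\<psi> = (\<Sum>\<phi>\<in>F. (- a \<phi>) *\<^sub>R \<phi>)"
  have \<psi>: "\<psi> \<in> D" "\<Lambda> \<psi> = (\<Sum>\<phi>\<in>F. (- a \<phi>) * \<Lambda> \<phi>)"
    unfolding \<psi>_def using linear_sum_scaleR[OF D(1) F, of \<Lambda> "\<lambda>\<phi>. - a \<phi>"] add scale by blast+
  have "0 \<le> \<psi> x" if "x \<in> C" for x
  proof -
    have "l (\<lambda>\<phi>. \<phi> x) \<le> q (\<lambda>\<phi>. \<phi> x)" using l(2) by (simp add: le_fun_def)
    also have "\<dots> = 0" using that by (rule q_eq_0) simp
    finally show ?thesis
      by (simp add: l_eq \<psi>_def sum_fun_eval scaleR_fun_def sum_negf)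
  qed
  from pos[OF \<psi>(1) this] have "q \<Lambda> \<le> 0"
    unfolding \<psi>(2) l(3)[symmetric] l_eq by (simp add: sum_negf)
  then have "q \<Lambda> < e" using e by simp
  then obtain x where x: "x \<in> C" "d \<Lambda> x < e"
    unfolding q_def using cInf_lessD[of "d \<Lambda> ` C" e] ne by auto
  have "\<bar>\<phi> x - \<Lambda> \<phi>\<bar> < e" if "\<phi> \<in> F" for \<phi>
  proof -
    have "\<bar>\<Lambda> \<phi> - \<phi> x\<bar> \<le> d \<Lambda> x"
      unfolding d_def using that F(1) by (intro member_le_sum) auto
    then show ?thesis using x(2) by (simp add: abs_minus_commute)
  qed
  with x(1) show thesis by (rule that)
qed

section \<open>The weak topology and representation of functionals by points of the cone\<close>

lemma openin_weak_topology:
  assumes "\<phi> \<in> continuous_dual T" "open S"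
  shows "openin (weak_topology T) (\<phi> -` S)"
  unfolding weak_topology_def using assms by (intro topology_generated_by_Basis) auto

lemma topspace_weak_topology: "topspace (weak_topology T) = UNIV"
proof -
  have "(\<lambda>_. 0) \<in> continuous_dual T"
    using subspace_0[OF subspace_continuous_dual, of T] by (simp add: zero_fun_def)
  from openin_weak_topology[OF this open_UNIV] show ?thesis
    using openin_subset by (fastforce simp del: vimage_const)
qed

lemma weak_topology_neighbourhood:
  assumes "openin (weak_topology T) U" "x \<in> U"
  obtains F e where "finite F" "F \<subseteq> continuous_dual T" "0 < (e::real)"
    "\<And>y. (\<And>\<phi>. \<phi> \<in> F \<Longrightarrow> \<bar>\<phi> y - \<phi> x\<bar> < e) \<Longrightarrow> y \<in> U"
proof -
  have "generate_topology_on {\<phi> -` U |\<phi> U. \<phi> \<in> continuous_dual T \<and> open U} U"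
    using assms(1) by (simp add: weak_topology_def openin_topology_generated_by_iff)
  then have "\<forall>x\<in>U. \<exists>F e. finite F \<and> F \<subseteq> continuous_dual T \<and> 0 < (e::real) \<and>
      (\<forall>y. (\<forall>\<phi>\<in>F. \<bar>\<phi> y - \<phi> x\<bar> < e) \<longrightarrow> y \<in> U)"
  proof induction
    case Empty
    show ?case by simp
  next
    case (Int U V)
    show ?case
    proof
      fix x assume "x \<in> U \<inter> V"
      then obtain F e G d where
        F: "finite F" "F \<subseteq> continuous_dual T" "0 < (e::real)"
          "\<And>y. (\<forall>\<phi>\<in>F. \<bar>\<phi> y - \<phi> x\<bar> < e) \<Longrightarrow> y \<in> U" and
        G: "finite G" "G \<subseteq> continuous_dual T" "0 < (d::real)"
          "\<And>y. (\<forall>\<phi>\<in>G. \<bar>\<phi> y - \<phi> x\<bar> < d) \<Longrightarrow> y \<in> V"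
        using Int.IH by (metis IntD1 IntD2)
      then show "\<exists>F e. finite F \<and> F \<subseteq> continuous_dual T \<and> 0 < (e::real) \<and>
          (\<forall>y. (\<forall>\<phi>\<in>F. \<bar>\<phi> y - \<phi> x\<bar> < e) \<longrightarrow> y \<in> U \<inter> V)"
        by (intro exI[of _ "F \<union> G"] exI[of _ "min e d"]) auto
    qed
  next
    case (UN K)
    show ?case
    proof
      fix x assume "x \<in> \<Union> K"
      then obtain k where "k \<in> K" "x \<in> k" by blast
      with UN.IH[of k] show "\<exists>F e. finite F \<and> F \<subseteq> continuous_dual T \<and> 0 < (e::real) \<and>
          (\<forall>y. (\<forall>\<phi>\<in>F. \<bar>\<phi> y - \<phi> x\<bar> < e) \<longrightarrow> y \<in> \<Union> K)"
        by (meson UnionI)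
    qed
  next
    case (Basis S)
    then obtain \<phi> U where S: "S = \<phi> -` U" "\<phi> \<in> continuous_dual T" "open U" by blast
    show ?case
    proof
      fix x assume "x \<in> S"
      with S obtain e where "0 < e" "\<And>z. \<bar>z - \<phi> x\<bar> < e \<Longrightarrow> z \<in> U"
        by (auto simp: open_dist dist_real_def)
      with S show "\<exists>F e. finite F \<and> F \<subseteq> continuous_dual T \<and> 0 < (e::real) \<and>
          (\<forall>y. (\<forall>\<phi>\<in>F. \<bar>\<phi> y - \<phi> x\<bar> < e) \<longrightarrow> y \<in> S)"
        by (intro exI[of _ "{\<phi>}"] exI[of _ e]) auto
    qed
  qed
  with assms(2) obtain F e where "finite F" "F \<subseteq> continuous_dual T" "0 < (e::real)"
      "\<forall>y. (\<forall>\<phi>\<in>F. \<bar>\<phi> y - \<phi> x\<bar> < e) \<longrightarrow> y \<in> U"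
    by metis
  then show thesis using that by metis
qed

text \<open>The sets of points of \<open>C\<close> whose evaluations are close to
  \<open>\<Lambda>\<close> at one functional generate a filter. The approximation lemma makes finite
  intersections non-empty, closeness to the common value \<open>\<Lambda> \<phi>\<close> makes the
  filter weakly Cauchy, and its limit in \<open>C\<close> must evaluate to
  \<open>\<Lambda>\<close>.\<close>

theorem weakly_complete_cone_represents:
  fixes C :: "'e::real_vector set" and \<Lambda> :: "('e \<Rightarrow> real) \<Rightarrow> real"
  assumes C: "convex_cone C" "weakly_complete T C"
    and add: "\<And>\<phi> \<psi>. \<phi> \<in> continuous_dual T \<Longrightarrow> \<psi> \<in> continuous_dual T \<Longrightarrow> \<Lambda> (\<phi> + \<psi>) = \<Lambda> \<phi> + \<Lambda> \<psi>"
    and scale: "\<And>c \<phi>. \<phi> \<in> continuous_dual T \<Longrightarrow> \<Lambda> (c *\<^sub>R \<phi>) = c * \<Lambda> \<phi>"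
    and pos: "\<And>\<phi>. \<phi> \<in> continuous_dual T \<Longrightarrow> (\<And>x. x \<in> C \<Longrightarrow> 0 \<le> \<phi> x) \<Longrightarrow> 0 \<le> \<Lambda> \<phi>"
  obtains x where "x \<in> C" "\<And>\<phi>. \<phi> \<in> continuous_dual T \<Longrightarrow> \<phi> x = \<Lambda> \<phi>"
proof -
  define D where "D = continuous_dual T"
  define B where "B = (\<lambda>(\<phi>, e). {x \<in> C. \<bar>\<phi> x - \<Lambda> \<phi>\<bar> < (e::real)})"
  define F where "F = (INF p\<in>D \<times> {0<..}. principal (B p))"
  have D: "subspace D" "\<And>\<phi>. \<phi> \<in> D \<Longrightarrow> linear \<phi>"
    unfolding D_def by (rule subspace_continuous_dual) (simp add: continuous_dual_def)
  have ev: "\<forall>\<^sub>F x in F. x \<in> C \<and> \<bar>\<phi> x - \<Lambda> \<phi>\<bar> < e" if "\<phi> \<in> D" "e > 0" for \<phi> e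
  proof -
    have "F \<le> principal (B (\<phi>, e))"
      unfolding F_def using that by (intro INF_lower) auto
    then show ?thesis by (simp add: le_principal B_def)
  qed
  have "F \<noteq> bot"
    unfolding F_def
  proof (rule INF_filter_not_bot)
    fix X :: "(('e \<Rightarrow> real) \<times> real) set" assume X: "X \<subseteq> D \<times> {0<..}" "finite X"
    \<comment> \<open>Inserting 1 keeps the minimum meaningful when \<open>X\<close> is
      empty.\<close>
    define e where "e = Min (insert 1 (snd ` X))"
    have e: "0 < e" "\<And>p. p \<in> X \<Longrightarrow> e \<le> snd p"
      using X unfolding e_def by (auto simp: Min_gr_iff Min_le_iff)
    obtain x where x: "x \<in> C" "\<And>\<phi>. \<phi> \<in> fst ` X \<Longrightarrow> \<bar>\<phi> x - \<Lambda> \<phi>\<bar> < e"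
      by (rule positive_functional_approximation[OF C(1) D, of \<Lambda> "fst ` X" e])
        (use X e(1) in \<open>auto simp: D_def add scale pos\<close>)
    have "x \<in> B p" if "p \<in> X" for p
      using x(1) x(2)[of "fst p"] e(2)[OF that] that by (auto simp: B_def split: prod.splits)
    then have "(\<Inter>p\<in>X. B p) \<noteq> {}" by blast
    then show "(INF p\<in>X. principal (B p)) \<noteq> bot"
      by (simp add: INF_principal_finite X(2) principal_eq_bot_iff)
  qed
  moreover have "F \<le> principal C"
    using ev[OF subspace_0[OF D(1)] zero_less_one] by (auto simp: le_principal elim: eventually_mono)
  moreover have "\<forall>\<^sub>F (x, y) in F \<times>\<^sub>F F. x - y \<in> U" if U: "openin (weak_topology T) U" "0 \<in> U" for U
  proof -
    obtain G e where G: "finite G" "G \<subseteq> D" "0 < (e::real)"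
      "\<And>y. (\<And>\<phi>. \<phi> \<in> G \<Longrightarrow> \<bar>\<phi> y - \<phi> 0\<bar> < e) \<Longrightarrow> y \<in> U"
      using weak_topology_neighbourhood[OF U] unfolding D_def by metis
    have "\<forall>\<^sub>F x in F. \<forall>\<phi>\<in>G. \<bar>\<phi> x - \<Lambda> \<phi>\<bar> < e / 2"
      using G by (intro eventually_ball_finite) (auto intro!: eventually_mono[OF ev[of _ "e / 2"]])
    from eventually_prodI[OF this this]
    have "\<forall>\<^sub>F p in F \<times>\<^sub>F F. (\<forall>\<phi>\<in>G. \<bar>\<phi> (fst p) - \<Lambda> \<phi>\<bar> < e / 2) \<and> (\<forall>\<phi>\<in>G. \<bar>\<phi> (snd p) - \<Lambda> \<phi>\<bar> < e / 2)" .
    then show ?thesis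
    proof (rule eventually_mono)
      fix p :: "'e \<times> 'e"
      assume p: "(\<forall>\<phi>\<in>G. \<bar>\<phi> (fst p) - \<Lambda> \<phi>\<bar> < e / 2) \<and> (\<forall>\<phi>\<in>G. \<bar>\<phi> (snd p) - \<Lambda> \<phi>\<bar> < e / 2)"
      have "fst p - snd p \<in> U"
      proof (rule G(4))
        fix \<phi> assume "\<phi> \<in> G"
        then have "\<bar>\<phi> (fst p) - \<Lambda> \<phi>\<bar> < e / 2" "\<bar>\<phi> (snd p) - \<Lambda> \<phi>\<bar> < e / 2" "linear \<phi>"
          using p G(2) D(2) by auto
        then show "\<bar>\<phi> (fst p - snd p) - \<phi> 0\<bar> < e"
          unfolding linear_diff[OF \<open>linear \<phi>\<close>] linear_0[OF \<open>linear \<phi>\<close>] by linarith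
      qed
      then show "case p of (x, y) \<Rightarrow> x - y \<in> U" by (simp add: case_prod_beta)
    qed
  qed
  ultimately obtain x where x: "x \<in> C" "limitin (weak_topology T) (\<lambda>y. y) x F"
    using C(2) unfolding weakly_complete_def tvs_complete_def by blast
  have "\<phi> x = \<Lambda> \<phi>" if \<phi>: "\<phi> \<in> D" for \<phi>
  proof -
    have "\<bar>\<phi> x - \<Lambda> \<phi>\<bar> \<le> 0 + e" if e: "e > 0" for e
    proof -
      have "openin (weak_topology T) (\<phi> -` ball (\<phi> x) (e / 2))"
        using \<phi> unfolding D_def by (rule openin_weak_topology) simp
      then have "\<forall>\<^sub>F y in F. y \<in> \<phi> -` ball (\<phi> x) (e / 2)"
        using x(2) e unfolding limitin_def by (metis centre_in_ball half_gt_zero vimageI2)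
      moreover have "\<forall>\<^sub>F y in F. y \<in> C \<and> \<bar>\<phi> y - \<Lambda> \<phi>\<bar> < e / 2"
        using ev[OF \<phi>, of "e / 2"] e by simp
      ultimately have "\<forall>\<^sub>F y in F. \<bar>\<phi> x - \<Lambda> \<phi>\<bar> \<le> 0 + e"
      proof eventually_elim
        case (elim y)
        then have "\<bar>\<phi> x - \<phi> y\<bar> < e / 2" by (simp add: dist_real_def)
        with elim(2) show ?case by linarith
      qed
      then show ?thesis
        using \<open>F \<noteq> bot\<close> by simp
    qed
    then have "\<bar>\<phi> x - \<Lambda> \<phi>\<bar> \<le> 0" by (rule field_le_epsilon)
    then show ?thesis by simp
  qed
  with x(1) show thesis unfolding D_def by (rule that)
qed

section \<open>The space of all functions with the topology of pointwise convergence\<close>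

definition pointwise_topology :: "('x \<Rightarrow> real) topology" where
  "pointwise_topology = product_topology (\<lambda>_. euclideanreal) UNIV"

lemma topspace_pointwise [simp]: "topspace pointwise_topology = UNIV"
  by (simp add: pointwise_topology_def)

lemma continuous_map_pointwise_eval: "continuous_map pointwise_topology euclideanreal (\<lambda>v. v x)"
  unfolding pointwise_topology_def by (rule continuous_map_product_projection) simp

lemma continuous_map_to_pointwise:
  "continuous_map X pointwise_topology f \<longleftrightarrow> (\<forall>x. continuous_map X euclideanreal (\<lambda>v. f v x))"
  unfolding pointwise_topology_def by (rule continuous_map_componentwise_UNIV)

lemma openin_pointwise_ball:
  assumes "finite F"
  shows "openin pointwise_topology {w. \<forall>x\<in>F. \<bar>w x - v x\<bar> < e}"
  using assms
proof induction
  case empty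
  show ?case using openin_topspace[of pointwise_topology] by simp
next
  case (insert x F)
  have "openin pointwise_topology {w. w x \<in> ball (v x) e}"
    using openin_continuous_map_preimage[OF continuous_map_pointwise_eval, of "ball (v x) e" x] by simp
  moreover have "{w. \<forall>x\<in>insert x F. \<bar>w x - v x\<bar> < e} =
      {w. w x \<in> ball (v x) e} \<inter> {w. \<forall>x\<in>F. \<bar>w x - v x\<bar> < e}"
    by (auto simp: dist_real_def)
  ultimately show ?case using insert.IH by (simp only: openin_Int)
qed

lemma pointwise_neighbourhood:
  assumes "openin pointwise_topology U" "v \<in> U"
  obtains F e where "finite F" "0 < (e::real)" "{w. \<forall>x\<in>F. \<bar>w x - v x\<bar> < e} \<subseteq> U"
proof -
  obtain S where S: "finite {x. S x \<noteq> (UNIV :: real set)}" "\<And>x. open (S x)"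
    "v \<in> PiE UNIV S" "PiE UNIV S \<subseteq> U"
    using assms unfolding pointwise_topology_def openin_product_topology_alt by auto
  define F where "F = {x. S x \<noteq> UNIV}"
  have "\<exists>e>0. \<forall>z. \<bar>z - v x\<bar> < e \<longrightarrow> z \<in> S x" for x
    using S(2)[of x] S(3) by (auto simp: open_dist dist_real_def)
  then obtain d where d: "\<And>x. d x > 0" "\<And>x z. \<bar>z - v x\<bar> < d x \<Longrightarrow> z \<in> S x"
    by metis
  define e where "e = Min (insert 1 (d ` F))"
  have "finite F" using S(1) by (simp add: F_def)
  then have e: "e > 0" "\<And>x. x \<in> F \<Longrightarrow> e \<le> d x"
    using d(1) unfolding e_def by (auto simp: Min_gr_iff)
  have "w \<in> U" if w: "\<forall>x\<in>F. \<bar>w x - v x\<bar> < e" for w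
  proof -
    have "w x \<in> S x" for x
    proof (cases "x \<in> F")
      case True
      then show ?thesis using d(2)[of "w x" x] w e(2)[OF True] by force
    qed (simp add: F_def)
    then show ?thesis using S(4) by auto
  qed
  with \<open>finite F\<close> e(1) show thesis by (intro that) auto
qed

lemma locally_convex_pointwise: "locally_convex_space (pointwise_topology :: ('x \<Rightarrow> real) topology)"
  unfolding locally_convex_space_def
proof (intro conjI)
  let ?T = "pointwise_topology :: ('x \<Rightarrow> real) topology"
  show "topspace ?T = UNIV" by simp
  show "Hausdorff_space ?T"
    by (simp add: pointwise_topology_def Hausdorff_space_product_topology)
  have eval: "continuous_map X euclideanreal (\<lambda>p. h p x)" if "continuous_map X ?T h" for X :: "'y topology" and h x
    using that by (simp add: continuous_map_to_pointwise)
  show "continuous_map (prod_topology ?T ?T) ?T (\<lambda>(x, y). x + y)"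
    unfolding continuous_map_to_pointwise case_prod_beta plus_fun_def
    by (intro allI continuous_map_add eval continuous_map_fst continuous_map_snd)
  show "continuous_map (prod_topology euclideanreal ?T) ?T (\<lambda>(c, x). c *\<^sub>R x)"
    unfolding continuous_map_to_pointwise case_prod_beta scaleR_fun_def real_scaleR_def
    by (intro allI continuous_map_real_mult eval continuous_map_fst continuous_map_snd)
  show "neighbourhood_base_at 0 convex ?T"
    unfolding neighbourhood_base_at_def
  proof (intro allI impI, elim conjE)
    fix W assume "openin ?T W" "0 \<in> W"
    then obtain F e where F: "finite F" "0 < (e::real)" "{w. \<forall>x\<in>F. \<bar>w x - 0 x\<bar> < e} \<subseteq> W"
      by (rule pointwise_neighbourhood)
    let ?B = "{w :: 'x \<Rightarrow> real. \<forall>x\<in>F. \<bar>w x - 0 x\<bar> < e}"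
    have "convex ?B"
    proof (rule convexI, clarsimp simp: scaleR_fun_def)
      fix a b :: real and v w x
      assume ab: "0 \<le> a" "0 \<le> b" "a + b = 1" and "x \<in> F" "\<forall>x\<in>F. \<bar>v x\<bar> < e" "\<forall>x\<in>F. \<bar>w x\<bar> < e"
      then have "v x \<in> ball 0 e" "w x \<in> ball 0 e" by auto
      from convexD[OF convex_ball this ab] show "\<bar>a * v x + b * w x\<bar> < e" by simp
    qed
    moreover have "openin ?T ?B" by (rule openin_pointwise_ball[OF F(1)])
    ultimately show "\<exists>U V. openin ?T U \<and> convex V \<and> 0 \<in> U \<and> U \<subseteq> V \<and> V \<subseteq> W"
      using F by (intro exI[of _ ?B]) auto
  qed
qed

text \<open>A neighbourhood of 0 restricts finitely many coordinates \<open>F\<close>. On the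
  subspace of functions vanishing on \<open>F\<close> the functional is bounded by 1, hence zero, so
  it depends on the coordinates in \<open>F\<close> alone.\<close>

lemma continuous_dual_pointwise:
  assumes "\<phi> \<in> continuous_dual (pointwise_topology :: ('x \<Rightarrow> real) topology)"
  obtains F c where "finite F" "\<phi> = (\<lambda>v. \<Sum>x\<in>F. c x * v x)"
proof -
  have lin: "linear \<phi>" using assms by (simp add: continuous_dual_def)
  have "openin pointwise_topology {v. \<phi> v \<in> ball 0 1}"
    using openin_continuous_map_preimage[of pointwise_topology euclideanreal \<phi> "ball 0 1"] assms
    by (simp add: continuous_dual_def)
  moreover have "0 \<in> {v. \<phi> v \<in> ball 0 1}" by (simp add: linear_0[OF lin])
  ultimately obtain F e where F: "finite F" "0 < (e::real)"
    "{w. \<forall>x\<in>F. \<bar>w x - 0 x\<bar> < e} \<subseteq> {v. \<phi> v \<in> ball 0 1}"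
    by (rule pointwise_neighbourhood)
  have zero: "\<phi> w = 0" if w: "\<And>x. x \<in> F \<Longrightarrow> w x = 0" for w
  proof (rule ccontr)
    assume nz: "\<phi> w \<noteq> 0"
    have "inverse (\<phi> w) *\<^sub>R w \<in> {w. \<forall>x\<in>F. \<bar>w x - 0 x\<bar> < e}"
      using w F(2) by (simp add: scaleR_fun_def)
    with F(3) have "\<bar>\<phi> (inverse (\<phi> w) *\<^sub>R w)\<bar> < 1" by auto
    then show False using nz by (simp add: linear_cmul[OF lin])
  qed
  let ?d = "\<lambda>x y. if y = x then 1 else (0::real)"
  have "\<phi> v = (\<Sum>x\<in>F. \<phi> (?d x) * v x)" for v
  proof -
    have "\<phi> (v - (\<Sum>x\<in>F. v x *\<^sub>R ?d x)) = 0"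
      using F(1) by (intro zero) (simp add: sum_fun_eval scaleR_fun_def if_distrib cong: if_cong)
    then show ?thesis
      unfolding linear_diff[OF lin] linear_sum[OF lin] linear_cmul[OF lin]
      by (simp add: mult.commute)
  qed
  then have "\<phi> = (\<lambda>v. \<Sum>x\<in>F. \<phi> (?d x) * v x)" by (rule ext)
  with F(1) show thesis by (rule that)
qed

lemma tvs_bounded_pointwise:
  fixes B :: "('x \<Rightarrow> real) set"
  assumes "\<And>v x. v \<in> B \<Longrightarrow> \<bar>v x\<bar> \<le> M x"
  shows "tvs_bounded pointwise_topology B"
  unfolding tvs_bounded_def
proof (intro allI impI, elim conjE)
  fix U assume "openin pointwise_topology U" "(0 :: 'x \<Rightarrow> real) \<in> U"
  then obtain F e where F: "finite F" "0 < (e::real)" "{w. \<forall>x\<in>F. \<bar>w x - 0 x\<bar> < e} \<subseteq> U"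
    by (rule pointwise_neighbourhood)
  \<comment> \<open>The summand 1 makes \<open>r\<close> positive and the later estimate
    strict.\<close>
  define r where "r = ((\<Sum>x\<in>F. \<bar>M x\<bar>) + 1) / e"
  have r: "r > 0" unfolding r_def using F(2) by (intro divide_pos_pos) (auto intro: add_nonneg_pos sum_nonneg)
  have "v \<in> (\<lambda>x. t *\<^sub>R x) ` U" if t: "\<bar>t\<bar> \<ge> r" and v: "v \<in> B" for t v
  proof -
    have t0: "t \<noteq> 0" "\<bar>t\<bar> > 0" using t r by auto
    have "\<bar>inverse t * v x\<bar> < e" if "x \<in> F" for x
    proof -
      have "\<bar>v x\<bar> \<le> \<bar>M x\<bar>" using assms[OF v, of x] by linarith
      also have "\<dots> \<le> (\<Sum>x\<in>F. \<bar>M x\<bar>)"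
        using that F(1) by (intro member_le_sum) auto
      also have "\<dots> < r * e" using F(2) by (simp add: r_def)
      also have "\<dots> \<le> \<bar>t\<bar> * e" using t F(2) by simp
      finally show ?thesis using t0 by (simp add: abs_mult field_simps)
    qed
    then have "inverse t *\<^sub>R v \<in> U"
      using F(3) by (auto simp: scaleR_fun_def)
    moreover have "v = t *\<^sub>R (inverse t *\<^sub>R v)" using t0 by simp
    ultimately show ?thesis by blast
  qed
  with r show "\<exists>r>0. \<forall>t. r \<le> \<bar>t\<bar> \<longrightarrow> B \<subseteq> (\<lambda>x. t *\<^sub>R x) ` U" by blast
qed

lemma eval_in_continuous_dual: "(\<lambda>v. v x) \<in> continuous_dual pointwise_topology"
  using continuous_map_pointwise_eval
  by (auto simp: continuous_dual_def scaleR_fun_def intro!: linearI)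

text \<open>Evaluations are continuous functionals, so a weakly Cauchy filter is Cauchy in each
  coordinate and converges pointwise by completeness of the reals. Every continuous functional
  respects this convergence, which makes it weak convergence. It remains to know that
  \<open>C\<close> contains its pointwise limits.\<close>

lemma weakly_complete_pointwise:
  fixes C :: "('x \<Rightarrow> real) set"
  assumes closed: "\<And>L \<Phi>. \<Phi> \<noteq> bot \<Longrightarrow> \<forall>\<^sub>F v in \<Phi>. v \<in> C \<Longrightarrow>
    (\<And>x. ((\<lambda>v. v x) \<longlongrightarrow> L x) \<Phi>) \<Longrightarrow> L \<in> C"
  shows "weakly_complete pointwise_topology C"
  unfolding weakly_complete_def tvs_complete_def
proof (intro allI impI, elim conjE)
  fix \<Phi> :: "('x \<Rightarrow> real) filter"
  assume \<Phi>: "\<Phi> \<noteq> bot" "\<Phi> \<le> principal C"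
    and cauchy: "\<forall>U. openin (weak_topology pointwise_topology) U \<and> 0 \<in> U \<longrightarrow>
      (\<forall>\<^sub>F (x, y) in \<Phi> \<times>\<^sub>F \<Phi>. x - y \<in> U)"
  have "\<exists>l. ((\<lambda>v. v x) \<longlongrightarrow> l) \<Phi>" for x
  proof -
    have "cauchy_filter (filtermap (\<lambda>v. v x) \<Phi>)"
      unfolding cauchy_filter_metric_filtermap
    proof (intro allI impI)
      fix e :: real assume "e > 0"
      then have "0 \<in> (\<lambda>v. v x) -` ball 0 e" by simp
      moreover have "openin (weak_topology pointwise_topology) ((\<lambda>v. v x) -` ball 0 e)"
        by (intro openin_weak_topology eval_in_continuous_dual) simp
      ultimately have "\<forall>\<^sub>F (v, w) in \<Phi> \<times>\<^sub>F \<Phi>. v - w \<in> (\<lambda>v. v x) -` ball 0 e"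
        using cauchy by blast
      then have "\<forall>\<^sub>F (v, w) in \<Phi> \<times>\<^sub>F \<Phi>. dist (v x) (w x) < e"
        by (rule eventually_mono) (auto simp: dist_real_def)
      then show "\<exists>P. eventually P \<Phi> \<and> (\<forall>v w. P v \<and> P w \<longrightarrow> dist (v x) (w x) < e)"
        unfolding eventually_prod_same by auto
    qed
    moreover have "filtermap (\<lambda>v. v x) \<Phi> \<noteq> bot" using \<Phi>(1) by (simp add: filtermap_bot_iff)
    ultimately show ?thesis
      using complete_UNIV[where 'a = real] unfolding complete_uniform filterlim_def by auto
  qed
  then obtain L where L: "\<And>x. ((\<lambda>v. v x) \<longlongrightarrow> L x) \<Phi>" by metis
  have "L \<in> C"
    using \<Phi> L by (intro closed) (auto simp: le_principal)
  moreover have "limitin (weak_topology pointwise_topology) (\<lambda>v. v) L \<Phi>"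
    unfolding limitin_def
  proof (intro conjI allI impI)
    show "L \<in> topspace (weak_topology pointwise_topology)" by (simp add: topspace_weak_topology)
    fix U assume "openin (weak_topology pointwise_topology) U \<and> L \<in> U"
    then have U: "openin (weak_topology pointwise_topology) U" "L \<in> U" by blast+
    obtain G e where G: "finite G" "G \<subseteq> continuous_dual pointwise_topology" "0 < (e::real)"
      "\<And>v. (\<And>\<phi>. \<phi> \<in> G \<Longrightarrow> \<bar>\<phi> v - \<phi> L\<bar> < e) \<Longrightarrow> v \<in> U"
      using weak_topology_neighbourhood[OF U] by metis
    have "limitin pointwise_topology (\<lambda>v. v) L \<Phi>"
      using L by (simp add: pointwise_topology_def limitin_componentwise)
    then have lim: "((\<lambda>v. \<phi> v) \<longlongrightarrow> \<phi> L) \<Phi>" if "\<phi> \<in> G" for \<phi>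
      using continuous_map_limit[of pointwise_topology euclideanreal \<phi> "\<lambda>v. v" L \<Phi>] that G(2)
      by (auto simp: continuous_dual_def o_def)
    have "\<forall>\<^sub>F v in \<Phi>. \<bar>\<phi> v - \<phi> L\<bar> < e" if "\<phi> \<in> G" for \<phi>
      using tendstoD[OF lim[OF that] G(3)] by (simp add: dist_real_def)
    then have "\<forall>\<^sub>F v in \<Phi>. \<forall>\<phi>\<in>G. \<bar>\<phi> v - \<phi> L\<bar> < e"
      using G(1) by (simp add: eventually_ball_finite_distrib)
    then show "\<forall>\<^sub>F v in \<Phi>. v \<in> U"
      by (rule eventually_mono) (rule G(4), blast)
  qed
  ultimately show "\<exists>L\<in>C. limitin (weak_topology pointwise_topology) (\<lambda>v. v) L \<Phi>" by blast
qed

section \<open>From integrals to fixed points\<close>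

text \<open>Continuity of the orbit map at the identity is uniform continuity under perturbation of
  the argument from the left. Translation evaluates at \<open>- g + x\<close>, hence the passage
  through \<open>uminus\<close>. Continuity at an arbitrary \<open>g0\<close> reduces to the
  identity through \<open>- g + x = (- g + g0) + (- g0 + x)\<close>.\<close>

lemma Cb_ru_iff:
  "f \<in> Cb_ru \<longleftrightarrow>
     (\<forall>e>0. \<exists>V. open V \<and> 0 \<in> V \<and> (\<forall>a\<in>V. \<forall>x. \<bar>apply_bcontfun f (a + x) - apply_bcontfun f x\<bar> < e))"
  (is "_ \<longleftrightarrow> ?R")
proof
  assume "f \<in> Cb_ru"
  then have cont: "continuous_on UNIV (\<lambda>g. left_translate g f)" by (simp add: Cb_ru_def)
  show ?R
  proof (intro allI impI)
    fix e :: real assume e: "e > 0"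
    define S where "S = (\<lambda>g. left_translate g f) -` ball (left_translate 0 f) e"
    have "open (uminus -` S)"
      unfolding S_def
      by (intro open_vimage continuous_on_minus continuous_on_id cont) simp
    moreover have "0 \<in> uminus -` S" using e by (simp add: S_def)
    moreover have "\<bar>apply_bcontfun f (a + x) - apply_bcontfun f x\<bar> < e" if "a \<in> uminus -` S" for a x
    proof -
      have "dist (apply_bcontfun (left_translate 0 f) x) (apply_bcontfun (left_translate (- a) f) x) < e"
        using that by (intro le_less_trans[OF dist_bounded]) (simp add: S_def)
      then show ?thesis by (simp add: dist_real_def abs_minus_commute)
    qed
    ultimately show "\<exists>V. open V \<and> 0 \<in> V \<and>
        (\<forall>a\<in>V. \<forall>x. \<bar>apply_bcontfun f (a + x) - apply_bcontfun f x\<bar> < e)"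
      by blast
  qed
next
  assume R: ?R
  have "((\<lambda>g. left_translate g f) \<longlongrightarrow> left_translate g0 f) (at g0)" for g0
  proof (rule tendstoI)
    fix e :: real assume "e > 0"
    then obtain V where V: "open V" "0 \<in> V"
      "\<And>a x. a \<in> V \<Longrightarrow> \<bar>apply_bcontfun f (a + x) - apply_bcontfun f x\<bar> < e / 2"
      using R[rule_format, of "e / 2"] by auto
    define S where "S = (\<lambda>g. - g + g0) -` V"
    have "open S"
      unfolding S_def by (intro open_vimage V(1) continuous_intros)
    moreover have "dist (left_translate g f) (left_translate g0 f) < e" if "g \<in> S" for g
    proof -
      have "dist (left_translate g f) (left_translate g0 f) \<le> e / 2"
      proof (rule dist_bound)
        fix x
        have "- g + x = (- g + g0) + (- g0 + x)" by (simp add: add.assoc)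
        then show "dist (apply_bcontfun (left_translate g f) x) (apply_bcontfun (left_translate g0 f) x) \<le> e / 2"
          using V(3)[of "- g + g0" "- g0 + x"] that by (simp add: dist_real_def S_def)
      qed
      then show ?thesis using \<open>e > 0\<close> by simp
    qed
    moreover have "g0 \<in> S" using V(2) by (simp add: S_def)
    ultimately show "\<forall>\<^sub>F g in at g0. dist (left_translate g f) (left_translate g0 f) < e"
      unfolding eventually_at_topological by blast
  qed
  then show "f \<in> Cb_ru"
    by (simp add: Cb_ru_def continuous_on_def)
qed

lemma continuous_dual_comp_representation:
  assumes "cone_representation T C \<pi>" "\<phi> \<in> continuous_dual T"
  shows "\<phi> \<circ> \<pi> g \<in> continuous_dual T"
  using assms linear_compose[of "\<pi> g" \<phi>] continuous_map_compose[of T T "\<pi> g" euclideanreal \<phi>]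
  by (simp add: continuous_dual_def cone_representation_def)

text \<open>A cobounding functional may be replaced by the sum of translates that bounds it, which is
  non-negative on the cone.\<close>

lemma cobounded_type_nonneg:
  fixes \<pi> :: "'g::topological_group_add \<Rightarrow> 'e::real_vector \<Rightarrow> 'e"
  assumes rep: "cone_representation T C \<pi>" and cob: "cobounded_type T C \<pi>"
  obtains \<phi> where "\<phi> \<in> continuous_dual T" "\<And>c. c \<in> C \<Longrightarrow> 0 \<le> \<phi> c"
    "\<And>\<psi>. \<psi> \<in> continuous_dual T \<Longrightarrow>
       \<exists>(n::nat) (g :: nat \<Rightarrow> 'g). \<forall>c\<in>C. \<bar>\<psi> c\<bar> \<le> (\<Sum>j=1..n. \<phi> (\<pi> (- g j) c))"
proof -
  obtain \<mu> where \<mu>: "\<mu> \<in> continuous_dual T" and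
    bound: "\<And>\<psi>. \<psi> \<in> continuous_dual T \<Longrightarrow>
      \<exists>(n::nat) (g :: nat \<Rightarrow> 'g). \<forall>c\<in>C. \<bar>\<psi> c\<bar> \<le> (\<Sum>j=1..n. \<mu> (\<pi> (- g j) c))"
    using cob unfolding cobounded_type_def cone_le_def adjoint_rep_def
    by (fastforce simp: abs_le_iff)
  from bound[OF \<mu>] obtain n :: nat and g :: "nat \<Rightarrow> 'g"
    where g: "\<And>c. c \<in> C \<Longrightarrow> \<bar>\<mu> c\<bar> \<le> (\<Sum>j=1..n. \<mu> (\<pi> (- g j) c))" by blast
  define \<phi> where "\<phi> = (\<Sum>j=1..n. \<mu> \<circ> \<pi> (- g j))"
  have \<phi>_eq: "\<phi> c = (\<Sum>j=1..n. \<mu> (\<pi> (- g j) c))" for c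
    by (simp add: \<phi>_def sum_fun_eval)
  have "\<mu> \<circ> \<pi> h \<in> continuous_dual T" for h
    using rep \<mu> by (rule continuous_dual_comp_representation)
  then have "\<phi> \<in> continuous_dual T"
    unfolding \<phi>_def by (intro subspace_sum subspace_continuous_dual) auto
  moreover have "0 \<le> \<phi> c" if "c \<in> C" for c
    using g[OF that] by (simp add: \<phi>_eq)
  moreover have "\<exists>(n::nat) (g :: nat \<Rightarrow> 'g). \<forall>c\<in>C. \<bar>\<psi> c\<bar> \<le> (\<Sum>j=1..n. \<phi> (\<pi> (- g j) c))"
    if \<psi>: "\<psi> \<in> continuous_dual T" for \<psi>
  proof -
    obtain m and h :: "nat \<Rightarrow> 'g"
      where h: "\<And>c. c \<in> C \<Longrightarrow> \<bar>\<psi> c\<bar> \<le> (\<Sum>j=1..m. \<mu> (\<pi> (- h j) c))"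
      using bound[OF \<psi>] by blast
    \<comment> \<open>The cone is invariant, so \<open>\<mu> \<le> \<phi>\<close> may be applied at
      each moved point \<open>\<pi> (- h j) c\<close>.\<close>
    have "\<bar>\<psi> c\<bar> \<le> (\<Sum>j=1..m. \<phi> (\<pi> (- h j) c))" if "c \<in> C" for c
    proof (rule order_trans[OF h[OF that]], rule sum_mono)
      fix j
      have "\<pi> (- h j) c \<in> C" using that rep by (auto simp: cone_representation_def)
      from g[OF this] show "\<mu> (\<pi> (- h j) c) \<le> \<phi> (\<pi> (- h j) c)"
        by (simp add: \<phi>_eq)
    qed
    then show ?thesis by blast
  qed
  ultimately show thesis by (rule that)
qed

theorem fixed_point_if_integral:
  assumes int: "invariant_normalized_integral_property TYPE('g::topological_group_add)"
  shows "fixed_point_property_for_cones TYPE('g) TYPE('e::real_vector)"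
  unfolding fixed_point_property_for_cones_def
proof (intro allI impI, elim conjE)
  fix T :: "'e topology" and C and \<pi> :: "'g \<Rightarrow> 'e \<Rightarrow> 'e"
  assume T: "locally_convex_space T" and C: "proper_cone C" "weakly_complete T C"
    and rep: "cone_representation T C \<pi>"
    and ruc: "locally_bounded_ruc T C \<pi>" and cob: "cobounded_type T C \<pi>"
  let ?D = "continuous_dual T"
  have top: "topspace T = UNIV" using T by (simp add: locally_convex_space_def)
  have linD: "linear \<phi>" if "\<phi> \<in> ?D" for \<phi> using that by (simp add: continuous_dual_def)
  have \<pi>: "\<pi> 0 x = x" "\<pi> (g + h) x = \<pi> g (\<pi> h x)" for g h x
    using rep by (auto simp: cone_representation_def)
  have \<pi>C: "\<pi> g c \<in> C" if "c \<in> C" for g c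
    using rep that by (auto simp: cone_representation_def)
  have dual_\<pi>: "\<phi> \<circ> \<pi> g \<in> ?D" if "\<phi> \<in> ?D" for \<phi> g
    using rep that by (rule continuous_dual_comp_representation)
  obtain x0 where x0: "x0 \<in> C" "x0 \<noteq> 0" "tvs_bounded T (range (\<lambda>g. \<pi> g x0))"
    and orbit: "\<forall>U. openin T U \<and> 0 \<in> U \<longrightarrow>
           (\<exists>V. open V \<and> 0 \<in> V \<and> (\<forall>a\<in>V. \<forall>g. \<pi> (a + g) x0 - \<pi> g x0 \<in> U))"
    using ruc unfolding locally_bounded_ruc_def by (elim bexE conjE) (rule that)
  define nb where "nb = (\<lambda>(\<phi> :: 'e \<Rightarrow> real) e. \<phi> -` ball 0 e)"
  have nb: "openin T (nb \<phi> e)" "0 \<in> nb \<phi> e" if "\<phi> \<in> ?D" "e > 0" for \<phi> and e :: real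
  proof -
    show "openin T (nb \<phi> e)"
      using that openin_continuous_map_preimage[of T euclideanreal \<phi> "ball 0 e"]
      by (simp add: continuous_dual_def nb_def top vimage_def)
    show "0 \<in> nb \<phi> e" using that by (simp add: nb_def linear_0[OF linD])
  qed
  have unif: "\<exists>V. open V \<and> 0 \<in> V \<and> (\<forall>a\<in>V. \<forall>g. \<bar>\<phi> (\<pi> (a + g) x0) - \<phi> (\<pi> g x0)\<bar> < e)"
    if "\<phi> \<in> ?D" "e > 0" for \<phi> and e :: real
    using orbit[rule_format, OF conjI[OF nb[OF that]]] by (simp add: nb_def linear_diff[OF linD[OF that(1)]])
  \<comment> \<open>The coefficient function of \<open>\<phi>\<close> along the orbit. It is linear
    in \<open>\<phi>\<close> on the dual, so integrating it gives a linear functional there.\<close>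
  define cf where "cf = (\<lambda>\<phi> :: 'e \<Rightarrow> real. Bcontfun (\<lambda>g. \<phi> (\<pi> g x0)))"
  have cf: "apply_bcontfun (cf \<phi>) g = \<phi> (\<pi> g x0)" if \<phi>: "\<phi> \<in> ?D" for \<phi> g
  proof -
    have "((\<lambda>g. \<phi> (\<pi> g x0)) \<longlongrightarrow> \<phi> (\<pi> g0 x0)) (at g0)" for g0
    proof (rule tendstoI)
      fix e :: real assume "e > 0"
      then obtain V where V: "open V" "0 \<in> V"
        "\<And>a g. a \<in> V \<Longrightarrow> \<bar>\<phi> (\<pi> (a + g) x0) - \<phi> (\<pi> g x0)\<bar> < e"
        using unif[OF \<phi>] by meson
      \<comment> \<open>Writing \<open>g = (g - g0) + g0\<close> puts the perturbation on the left,
        where the orbit is uniformly continuous.\<close>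
      define S where "S = (\<lambda>g. g - g0) -` V"
      have "open S"
        unfolding S_def by (intro open_vimage V(1) continuous_intros)
      moreover have "dist (\<phi> (\<pi> g x0)) (\<phi> (\<pi> g0 x0)) < e" if "g \<in> S" for g
        using V(3)[of "g - g0" g0] that by (simp add: S_def dist_real_def)
      moreover have "g0 \<in> S" using V(2) by (simp add: S_def)
      ultimately show "\<forall>\<^sub>F g in at g0. dist (\<phi> (\<pi> g x0)) (\<phi> (\<pi> g0 x0)) < e"
        unfolding eventually_at_topological by blast
    qed
    then have "continuous_on UNIV (\<lambda>g. \<phi> (\<pi> g x0))"
      by (simp add: continuous_on_def)
    \<comment> \<open>The neighbourhood \<open>nb \<phi> 1\<close> absorbs the orbit, and the
      absorbing factor \<open>r\<close> bounds \<open>\<phi>\<close> on it.\<close>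
    moreover have "bounded (range (\<lambda>g. \<phi> (\<pi> g x0)))"
    proof -
      obtain r where "\<And>t. \<bar>t\<bar> \<ge> r \<Longrightarrow> range (\<lambda>g. \<pi> g x0) \<subseteq> (\<lambda>x. t *\<^sub>R x) ` nb \<phi> 1" "r > 0"
        using x0(3) nb[OF \<phi> zero_less_one] unfolding tvs_bounded_def by metis
      then have r: "range (\<lambda>g. \<pi> g x0) \<subseteq> (\<lambda>x. r *\<^sub>R x) ` nb \<phi> 1" "r > 0" by auto
      have "\<bar>\<phi> (\<pi> g x0)\<bar> \<le> r" for g
      proof -
        have "\<pi> g x0 \<in> (\<lambda>x. r *\<^sub>R x) ` nb \<phi> 1" using r(1) by blast
        then obtain v where "\<pi> g x0 = r *\<^sub>R v" "v \<in> nb \<phi> 1"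
          by (rule imageE)
        then have "\<pi> g x0 = r *\<^sub>R v" "\<bar>\<phi> v\<bar> < 1" by (simp_all add: nb_def)
        then show ?thesis using r(2)
          by (simp add: linear_cmul[OF linD[OF \<phi>]] abs_mult mult_left_le)
      qed
      then show ?thesis by (auto simp: bounded_iff)
    qed
    ultimately have "(\<lambda>g. \<phi> (\<pi> g x0)) \<in> bcontfun" by (simp add: bcontfun_def)
    then show ?thesis by (simp add: cf_def Bcontfun_inverse)
  qed
  have cf_ru: "cf \<phi> \<in> Cb_ru" if "\<phi> \<in> ?D" for \<phi>
    unfolding Cb_ru_iff cf[OF that] using unif[OF that] by blast
  obtain \<kappa> where \<kappa>: "\<kappa> \<in> ?D" "\<And>c. c \<in> C \<Longrightarrow> 0 \<le> \<kappa> c"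
    "\<And>\<psi>. \<psi> \<in> ?D \<Longrightarrow> \<exists>(n::nat) (g :: nat \<Rightarrow> 'g). \<forall>c\<in>C. \<bar>\<psi> c\<bar> \<le> (\<Sum>j=1..n. \<kappa> (\<pi> (- g j) c))"
    using cobounded_type_nonneg[OF rep cob] by blast
  \<comment> \<open>Evaluated at the orbit point \<open>\<pi> h x0\<close>, the term
    \<open>\<kappa> (\<pi> (- g j) c)\<close> is \<open>cf \<kappa>\<close> at
    \<open>- g j + h\<close>, that is, a left translate of \<open>cf \<kappa>\<close>.\<close>
  have dom: "cf \<phi> \<in> Cb_ru_dominated (cf \<kappa>)" if \<phi>: "\<phi> \<in> ?D" for \<phi>
  proof -
    obtain n :: nat and g :: "nat \<Rightarrow> 'g"
      where "\<And>c. c \<in> C \<Longrightarrow> \<bar>\<phi> c\<bar> \<le> (\<Sum>j=1..n. \<kappa> (\<pi> (- g j) c))"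
      using \<kappa>(3)[OF \<phi>] by blast
    from this[OF \<pi>C[OF x0(1)]] show ?thesis
      unfolding Cb_ru_dominated_def using cf_ru[OF \<phi>] by (auto simp: cf \<phi> \<kappa>(1) \<pi>)
  qed
  \<comment> \<open>If \<open>\<kappa>\<close> vanished on the orbit, coboundedness would make every
    continuous functional vanish at \<open>x0\<close>, against separation of points.\<close>
  have "cf \<kappa> \<noteq> 0"
  proof
    assume "cf \<kappa> = 0"
    then have zero: "\<kappa> (\<pi> g x0) = 0" for g using cf[OF \<kappa>(1), of g] by simp
    obtain \<phi> where \<phi>: "\<phi> \<in> ?D" "\<phi> x0 \<noteq> 0"
      using continuous_dual_separates[OF T x0(2)] .
    from \<kappa>(3)[OF \<phi>(1)] x0(1) zero \<phi>(2) show False by fastforce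
  qed
  moreover have nonneg: "nonneg_fun (cf \<phi>)" if "\<phi> \<in> ?D" "\<And>c. c \<in> C \<Longrightarrow> 0 \<le> \<phi> c" for \<phi>
    using that \<pi>C[OF x0(1)] by (simp add: nonneg_fun_def cf)
  ultimately obtain I where "invariant_normalized_integral (cf \<kappa>) I"
    using int \<kappa>(1,2) cf_ru unfolding invariant_normalized_integral_property_def by blast
  then have I: "I (cf \<phi> + cf \<psi>) = I (cf \<phi>) + I (cf \<psi>)" "I (c *\<^sub>R cf \<phi>) = c * I (cf \<phi>)"
      "nonneg_fun (cf \<phi>) \<Longrightarrow> 0 \<le> I (cf \<phi>)" "I (left_translate g (cf \<phi>)) = I (cf \<phi>)" "I (cf \<kappa>) = 1"
    if "\<phi> \<in> ?D" "\<psi> \<in> ?D" for \<phi> \<psi> c g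
    using dom[OF that(1)] dom[OF that(2)] unfolding invariant_normalized_integral_def by blast+
  obtain x where x: "x \<in> C" "\<And>\<phi>. \<phi> \<in> ?D \<Longrightarrow> \<phi> x = I (cf \<phi>)"
  proof (rule weakly_complete_cone_represents[OF _ C(2), of "\<lambda>\<phi>. I (cf \<phi>)"])
    show "convex_cone C" using C(1) by (simp add: proper_cone_def)
    fix \<phi> assume \<phi>: "\<phi> \<in> ?D"
    show "I (cf (\<phi> + \<psi>)) = I (cf \<phi>) + I (cf \<psi>)" if \<psi>: "\<psi> \<in> ?D" for \<psi>
    proof -
      have "cf (\<phi> + \<psi>) = cf \<phi> + cf \<psi>"
        using \<phi> \<psi> subspace_add[OF subspace_continuous_dual \<phi> \<psi>] by (intro bcontfun_eqI) (simp add: cf)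
      then show ?thesis using I(1)[OF \<phi> \<psi>] by simp
    qed
    show "I (cf (c *\<^sub>R \<phi>)) = c * I (cf \<phi>)" for c
    proof -
      have "cf (c *\<^sub>R \<phi>) = c *\<^sub>R cf \<phi>"
        using \<phi> subspace_scale[OF subspace_continuous_dual \<phi>, of c]
        by (intro bcontfun_eqI) (simp add: cf scaleR_fun_def)
      then show ?thesis using I(2)[OF \<phi> \<phi>] by simp
    qed
    show "0 \<le> I (cf \<phi>)" if "\<And>c. c \<in> C \<Longrightarrow> 0 \<le> \<phi> c"
      using I(3)[OF \<phi> \<phi>] nonneg[OF \<phi> that] by simp
  next
    fix x assume "x \<in> C" "\<And>\<phi>. \<phi> \<in> ?D \<Longrightarrow> \<phi> x = I (cf \<phi>)"
    then show thesis by (rule that)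
  qed
  \<comment> \<open>Since functionals separate points, it suffices to compare
    \<open>\<phi> (\<pi> g x)\<close> with \<open>\<phi> x\<close>. Moving \<open>\<pi> g\<close>
    onto the functional translates its coefficient function by \<open>- g\<close>, which the
    integral ignores.\<close>
  have "\<pi> g x = x" for g
  proof (rule ccontr)
    assume "\<pi> g x \<noteq> x"
    then obtain \<phi> where \<phi>: "\<phi> \<in> ?D" "\<phi> (\<pi> g x - x) \<noteq> 0"
      using continuous_dual_separates[OF T, of "\<pi> g x - x"] by auto
    have "\<phi> (\<pi> g x) = I (cf (\<phi> \<circ> \<pi> g))"
      using x(2)[OF dual_\<pi>[OF \<phi>(1)], of g] by simp
    also have "cf (\<phi> \<circ> \<pi> g) = left_translate (- g) (cf \<phi>)"
      using \<phi>(1) dual_\<pi>[OF \<phi>(1)] by (intro bcontfun_eqI) (simp add: cf \<pi>)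
    also have "I \<dots> = \<phi> x"
      using I(4)[OF \<phi>(1) \<phi>(1)] x(2)[OF \<phi>(1)] by simp
    finally show False using \<phi>(2) by (simp add: linear_diff[OF linD[OF \<phi>(1)]])
  qed
  moreover have "x \<noteq> 0"
    using x(2)[OF \<kappa>(1)] I(5)[OF \<kappa>(1) \<kappa>(1)] linear_0[OF linD[OF \<kappa>(1)]] by auto
  ultimately show "\<exists>x\<in>C. x \<noteq> 0 \<and> (\<forall>g. \<pi> g x = x)"
    using x(1) by blast
qed

section \<open>From fixed points to integrals\<close>

text \<open>Abstracted from the group action because it is needed twice: for functions on the group,
  where it describes \<open>Cb_ru_dominated\<close>, and for functionals on the cone, where it
  expresses coboundedness.\<close>

definition orbit_dominated :: "('g \<Rightarrow> 'y \<Rightarrow> real) \<Rightarrow> 'y set \<Rightarrow> ('y \<Rightarrow> real) \<Rightarrow> bool" where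
  "orbit_dominated a Y u \<longleftrightarrow>
     (\<exists>(n::nat) (g :: nat \<Rightarrow> 'g). \<forall>y\<in>Y. \<bar>u y\<bar> \<le> (\<Sum>j=1..n. a (g j) y))"

lemma orbit_dominated_zero: "orbit_dominated a Y (\<lambda>_. 0)"
  unfolding orbit_dominated_def by (intro exI[of _ 0]) simp

lemma orbit_dominated_mono:
  assumes "orbit_dominated a Y v" "\<And>y. y \<in> Y \<Longrightarrow> \<bar>u y\<bar> \<le> \<bar>v y\<bar>"
  shows "orbit_dominated a Y u"
proof -
  obtain n :: nat and g where "\<forall>y\<in>Y. \<bar>v y\<bar> \<le> (\<Sum>j=1..n. a (g j) y)"
    using assms(1) unfolding orbit_dominated_def by blast
  with assms(2) have "\<forall>y\<in>Y. \<bar>u y\<bar> \<le> (\<Sum>j=1..n. a (g j) y)"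
    by (blast intro: order_trans)
  then show ?thesis unfolding orbit_dominated_def by (intro exI)
qed

text \<open>The two families of group elements are concatenated; \<open>?k\<close> shifts the second
  one by \<open>n\<close>.\<close>

lemma orbit_dominated_add:
  assumes "orbit_dominated a Y u" "orbit_dominated a Y v"
  shows "orbit_dominated a Y (\<lambda>y. u y + v y)"
proof -
  obtain n m :: nat and g h where
    u: "\<And>y. y \<in> Y \<Longrightarrow> \<bar>u y\<bar> \<le> (\<Sum>j=1..n. a (g j) y)" and
    v: "\<And>y. y \<in> Y \<Longrightarrow> \<bar>v y\<bar> \<le> (\<Sum>j=1..m. a (h j) y)"
    using assms unfolding orbit_dominated_def by blast
  let ?k = "\<lambda>j. if j \<le> n then g j else h (j - n)"
  have "(\<Sum>j=1..n + m. a (?k j) y) = (\<Sum>j=1..n. a (g j) y) + (\<Sum>j=1..m. a (h j) y)" for y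
    by (induction m) auto
  then have "\<bar>u y + v y\<bar> \<le> (\<Sum>j=1..n + m. a (?k j) y)" if "y \<in> Y" for y
    using u[OF that] v[OF that] abs_triangle_ineq[of "u y" "v y"] by simp
  then show ?thesis
    unfolding orbit_dominated_def by (intro exI[of _ "n + m"] exI[of _ ?k] ballI)
qed

text \<open>The dominating sums carry no coefficients, so the scalar is rounded up to a natural
  number and realised by repeated addition.\<close>

lemma orbit_dominated_scale:
  assumes "orbit_dominated a Y u"
  shows "orbit_dominated a Y (\<lambda>y. c * u y)"
proof -
  have "orbit_dominated a Y (\<lambda>y. real N * u y)" for N
    by (induction N) (auto simp: algebra_simps orbit_dominated_zero intro: orbit_dominated_add assms)
  from this[of "nat \<lceil>\<bar>c\<bar>\<rceil>"] show ?thesis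
    by (rule orbit_dominated_mono) (simp add: abs_mult mult_right_mono real_nat_ceiling_ge)
qed

lemma orbit_dominated_sum:
  assumes "finite F" "\<And>x. x \<in> F \<Longrightarrow> orbit_dominated a Y (u x)"
  shows "orbit_dominated a Y (\<lambda>y. \<Sum>x\<in>F. u x y)"
  using assms by (induction F) (auto simp: orbit_dominated_zero intro: orbit_dominated_add)

section \<open>Left translation on \<open>Cb_ru\<close> and on its dominated subspaces\<close>

lemma left_translate_add: "left_translate g (h + k) = left_translate g h + left_translate g k"
  and left_translate_scaleR: "left_translate g (c *\<^sub>R h) = c *\<^sub>R left_translate g h"
  and left_translate_left_translate: "left_translate g (left_translate g' h) = left_translate (g + g') h"
  and left_translate_zero: "left_translate 0 h = h"
  by (rule bcontfun_eqI, simp add: minus_add add.assoc del: add_uminus_conv_diff)+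

lemma nonneg_fun_left_translate: "nonneg_fun h \<Longrightarrow> nonneg_fun (left_translate g h)"
  by (simp add: nonneg_fun_def)

lemma subspace_Cb_ru: "subspace Cb_ru"
  unfolding subspace_def Cb_ru_def
  by (auto simp: left_translate_add left_translate_scaleR intro!: continuous_intros)
    (simp add: left_translate_def zero_bcontfun_def[symmetric])

text \<open>The orbit map of a translate is the original orbit map precomposed with the right
  translation \<open>k \<mapsto> k + g\<close>.\<close>

lemma left_translate_Cb_ru:
  assumes "h \<in> Cb_ru"
  shows "left_translate g h \<in> Cb_ru"
proof -
  have "continuous_on UNIV (\<lambda>k. left_translate k h)" using assms by (simp add: Cb_ru_def)
  then have "continuous_on UNIV ((\<lambda>k. left_translate k h) \<circ> (\<lambda>k. k + g))"
    by (intro continuous_on_compose continuous_intros) (auto intro: continuous_on_subset)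
  then show ?thesis by (simp add: Cb_ru_def o_def left_translate_left_translate)
qed

lemma Cb_ru_dominated_iff:
  "h \<in> Cb_ru_dominated f \<longleftrightarrow>
     h \<in> Cb_ru \<and> orbit_dominated (\<lambda>g. apply_bcontfun (left_translate g f)) UNIV (apply_bcontfun h)"
  by (simp add: Cb_ru_dominated_def orbit_dominated_def)

lemma subspace_Cb_ru_dominated: "subspace (Cb_ru_dominated f)"
  by (intro subspaceI) (simp_all add: Cb_ru_dominated_iff subspace_0[OF subspace_Cb_ru]
      subspace_add[OF subspace_Cb_ru] subspace_scale[OF subspace_Cb_ru] plus_bcontfun.rep_eq scaleR_bcontfun.rep_eq zero_bcontfun.rep_eq zero_fun_def
      orbit_dominated_zero orbit_dominated_add orbit_dominated_scale)

lemma left_translate_Cb_ru_dominated: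
  assumes "h \<in> Cb_ru_dominated f"
  shows "left_translate g h \<in> Cb_ru_dominated f"
proof -
  obtain n :: nat and k where k: "\<And>x. \<bar>apply_bcontfun h x\<bar> \<le> (\<Sum>j=1..n. apply_bcontfun (left_translate (k j) f) x)"
    using assms by (auto simp: Cb_ru_dominated_def)
  have "\<bar>apply_bcontfun (left_translate g h) x\<bar> \<le>
      (\<Sum>j=1..n. apply_bcontfun (left_translate (g + k j) f) x)" for x
    using k[of "- g + x"] by (simp add: minus_add add.assoc del: add_uminus_conv_diff)
  then show ?thesis
    using assms left_translate_Cb_ru unfolding Cb_ru_dominated_def
    by (auto intro!: exI[of _ n] exI[of _ "\<lambda>j. g + k j"] simp del: apply_left_translate)
qed

text \<open>The algebraic dual of \<open>Cb_ru_dominated f\<close> is realised inside the space of all functions on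
  \<open>'g \<Rightarrow>\<^sub>C real\<close> by extending functionals by zero.\<close>

definition positive_functionals :: "('g::topological_group_add \<Rightarrow>\<^sub>C real) \<Rightarrow> (('g \<Rightarrow>\<^sub>C real) \<Rightarrow> real) set" where
  "positive_functionals f = {v.
     (\<forall>h\<in>Cb_ru_dominated f. \<forall>k\<in>Cb_ru_dominated f. v (h + k) = v h + v k) \<and>
     (\<forall>c. \<forall>h\<in>Cb_ru_dominated f. v (c *\<^sub>R h) = c * v h) \<and>
     (\<forall>h\<in>Cb_ru_dominated f. nonneg_fun h \<longrightarrow> 0 \<le> v h) \<and>
     (\<forall>h. h \<notin> Cb_ru_dominated f \<longrightarrow> v h = 0)}"

lemma positive_functionalsD:
  assumes "v \<in> positive_functionals f"
  shows "h \<in> Cb_ru_dominated f \<Longrightarrow> k \<in> Cb_ru_dominated f \<Longrightarrow> v (h + k) = v h + v k"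
    and "h \<in> Cb_ru_dominated f \<Longrightarrow> v (c *\<^sub>R h) = c * v h"
    and "h \<in> Cb_ru_dominated f \<Longrightarrow> nonneg_fun h \<Longrightarrow> 0 \<le> v h"
    and "h \<notin> Cb_ru_dominated f \<Longrightarrow> v h = 0"
  using assms by (auto simp: positive_functionals_def)

lemma positive_functional_sum:
  assumes v: "v \<in> positive_functionals f"
    and k: "\<And>j. j \<in> J \<Longrightarrow> k j \<in> Cb_ru_dominated f"
  shows "v (\<Sum>j\<in>J. k j) = (\<Sum>j\<in>J. v (k j))"
  using k
proof (induction J rule: infinite_finite_induct)
  case (insert j J)
  then show ?case
    by (simp add: positive_functionalsD(1)[OF v] subspace_sum[OF subspace_Cb_ru_dominated])
qed (use positive_functionalsD(2)[OF v subspace_0[OF subspace_Cb_ru_dominated], of 0] in simp_all)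

text \<open>Positivity is applied to \<open>s - h\<close> and \<open>s + h\<close>, where
  \<open>s\<close> is the dominating sum of translates. The choice of \<open>n\<close> and
  \<open>g\<close> depends on \<open>h\<close> alone and not on \<open>v\<close>, as coboundedness
  requires.\<close>

lemma Cb_ru_dominated_majorant:
  assumes f: "f \<in> Cb_ru_dominated f" and h: "h \<in> Cb_ru_dominated f"
  obtains n :: nat and g :: "nat \<Rightarrow> 'g::topological_group_add"
  where "nonneg_fun ((\<Sum>j=1..n. left_translate (g j) f) - h)"
    "nonneg_fun ((\<Sum>j=1..n. left_translate (g j) f) + h)"
    "\<forall>v\<in>positive_functionals f. \<bar>v h\<bar> \<le> (\<Sum>j=1..n. v (left_translate (g j) f))"
proof -
  let ?D = "Cb_ru_dominated f"
  obtain n :: nat and g :: "nat \<Rightarrow> 'g"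
    where g: "\<And>x. \<bar>apply_bcontfun h x\<bar> \<le> (\<Sum>j=1..n. apply_bcontfun (left_translate (g j) f) x)"
    using h by (auto simp: Cb_ru_dominated_def)
  define s where "s = (\<Sum>j=1..n. left_translate (g j) f)"
  have s_eq: "apply_bcontfun s x = (\<Sum>j=1..n. apply_bcontfun (left_translate (g j) f) x)" for x
    unfolding s_def by (induction n) (auto simp: plus_bcontfun.rep_eq)
  have nonneg: "nonneg_fun (s - h)" "nonneg_fun (s + h)"
    using g by (simp_all add: nonneg_fun_def s_eq abs_le_iff minus_bcontfun.rep_eq plus_bcontfun.rep_eq)
      (smt (verit) g)
  have s: "s \<in> ?D"
    unfolding s_def by (intro subspace_sum[OF subspace_Cb_ru_dominated] left_translate_Cb_ru_dominated f)
  have "\<bar>v h\<bar> \<le> (\<Sum>j=1..n. v (left_translate (g j) f))" if v: "v \<in> positive_functionals f" for v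
  proof -
    have mh: "(- 1) *\<^sub>R h \<in> ?D" using subspace_scale[OF subspace_Cb_ru_dominated h] .
    have "0 \<le> v (s + h)" "0 \<le> v (s + (- 1) *\<^sub>R h)"
      using nonneg subspace_add[OF subspace_Cb_ru_dominated s h]
        subspace_add[OF subspace_Cb_ru_dominated s mh]
      by (auto intro!: positive_functionalsD(3)[OF v])
    then have "\<bar>v h\<bar> \<le> v s"
      using positive_functionalsD(2)[OF v h, of "- 1"]
      unfolding positive_functionalsD(1)[OF v s h] positive_functionalsD(1)[OF v s mh] by simp
    also have "v s = (\<Sum>j=1..n. v (left_translate (g j) f))"
      unfolding s_def by (intro positive_functional_sum[OF v] left_translate_Cb_ru_dominated f)
    finally show ?thesis .
  qed
  then have "\<forall>v\<in>positive_functionals f. \<bar>v h\<bar> \<le> (\<Sum>j=1..n. v (left_translate (g j) f))" ..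
  with nonneg show thesis unfolding s_def by (rule that)
qed

text \<open>If \<open>v\<close> and \<open>- v\<close> are positive, \<open>v\<close> vanishes on
  non-negative functions. Every dominated \<open>h\<close> comes with such functions
  \<open>s - h\<close> and \<open>s + h\<close>, so \<open>v h = 0\<close>; outside the subspace the
  extension by zero takes over.\<close>

lemma proper_cone_positive_functionals:
  assumes f: "f \<in> Cb_ru_dominated f"
  shows "proper_cone (positive_functionals f)"
proof -
  let ?C = "positive_functionals f" and ?D = "Cb_ru_dominated f"
  have cone: "convex_cone ?C"
    unfolding convex_cone_iff positive_functionals_def
    by (auto simp: scaleR_fun_def algebra_simps)
  moreover have "v = 0" if v: "v \<in> ?C" "- v \<in> ?C" for v
  proof
    fix h
    have zero: "v k = 0" if "k \<in> ?D" "nonneg_fun k" for k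
      using positive_functionalsD(3)[OF v(1) that] positive_functionalsD(3)[OF v(2) that] by simp
    show "v h = 0 h"
    proof (cases "h \<in> ?D")
      case h: True
      obtain n :: nat and g where "nonneg_fun ((\<Sum>j=1..n. left_translate (g j) f) - h)"
          "nonneg_fun ((\<Sum>j=1..n. left_translate (g j) f) + h)"
        using Cb_ru_dominated_majorant[OF f h] by blast
      moreover define s where "s = (\<Sum>j=1..n. left_translate (g j) f)"
      moreover have s: "s \<in> ?D"
        unfolding s_def by (intro subspace_sum[OF subspace_Cb_ru_dominated] left_translate_Cb_ru_dominated f)
      ultimately have "v (s - h) = 0" "v (s + h) = 0"
        using subspace_add[OF subspace_Cb_ru_dominated s h]
          subspace_diff[OF subspace_Cb_ru_dominated s h] zero by auto
      moreover have "v ((s - h) + h) = v (s - h) + v h"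
        using subspace_diff[OF subspace_Cb_ru_dominated s h] h by (rule positive_functionalsD(1)[OF v(1)])
      ultimately show ?thesis
        using positive_functionalsD(1)[OF v(1) s h] by simp
    qed (simp add: positive_functionalsD(4)[OF v(1)])
  qed
  moreover have "0 \<in> ?C" using cone by (simp add: convex_cone_iff)
  ultimately show ?thesis
    unfolding proper_cone_def by (force simp: image_iff)
qed

text \<open>Each defining condition is an equation or a weak inequality between finitely many
  coordinates of \<open>v\<close>, so it survives pointwise limits.\<close>

lemma weakly_complete_positive_functionals:
  "weakly_complete pointwise_topology (positive_functionals f)"
proof (rule weakly_complete_pointwise)
  fix L and \<Phi> :: "(('a \<Rightarrow>\<^sub>C real) \<Rightarrow> real) filter"
  assume \<Phi>: "\<Phi> \<noteq> bot" "\<forall>\<^sub>F v in \<Phi>. v \<in> positive_functionals f"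
    and L: "\<And>h. ((\<lambda>v. v h) \<longlongrightarrow> L h) \<Phi>"
  have eq: "L h = l" if "\<And>v. v \<in> positive_functionals f \<Longrightarrow> v h = r v" "(r \<longlongrightarrow> l) \<Phi>" for h r l
  proof (rule tendsto_unique[OF \<Phi>(1) L])
    have "\<forall>\<^sub>F v in \<Phi>. r v = v h"
      using \<Phi>(2) by (rule eventually_mono) (simp add: that(1))
    then show "((\<lambda>v. v h) \<longlongrightarrow> l) \<Phi>"
      using that(2) by (rule Lim_transform_eventually[rotated])
  qed
  show "L \<in> positive_functionals f"
    unfolding positive_functionals_def
  proof (intro CollectI conjI ballI allI impI)
    fix h k c assume h: "h \<in> Cb_ru_dominated f"
    show "L (h + k) = L h + L k" if k: "k \<in> Cb_ru_dominated f"
      using h k by (intro eq[of _ "\<lambda>v. v h + v k"] tendsto_add L) (rule positive_functionalsD(1))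
    show "L (c *\<^sub>R h) = c * L h"
      using h by (intro eq[of _ "\<lambda>v. c * v h"] tendsto_mult_left L) (rule positive_functionalsD(2))
    show "0 \<le> L h" if "nonneg_fun h"
      using h that \<Phi> by (intro tendsto_lowerbound[OF L _ \<Phi>(1)])
        (auto elim!: eventually_mono intro: positive_functionalsD(3))
  next
    fix h assume "h \<notin> Cb_ru_dominated f"
    then show "L h = 0"
      by (intro eq[of _ "\<lambda>_. 0"] tendsto_const) (rule positive_functionalsD(4))
  qed
qed

text \<open>The adjoint of left translation. The inverse makes it a left action, under which
  evaluation at \<open>p\<close> becomes evaluation at \<open>g + p\<close>.\<close>

definition translate_functional ::
    "'g::topological_group_add \<Rightarrow> (('g \<Rightarrow>\<^sub>C real) \<Rightarrow> real) \<Rightarrow> ('g \<Rightarrow>\<^sub>C real) \<Rightarrow> real" where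
  "translate_functional g v = (\<lambda>h. v (left_translate (- g) h))"

lemma left_translate_Cb_ru_dominated_iff:
  "left_translate g h \<in> Cb_ru_dominated f \<longleftrightarrow> h \<in> Cb_ru_dominated f"
  using left_translate_Cb_ru_dominated[of "left_translate g h" f "- g"]
    left_translate_Cb_ru_dominated[of h f g]
  by (auto simp: left_translate_left_translate left_translate_zero)

lemma cone_representation_translate_functional:
  "cone_representation pointwise_topology (positive_functionals f) translate_functional"
  unfolding cone_representation_def
proof (intro conjI allI)
  fix g :: 'a
  show "linear (translate_functional g)"
    by (rule linearI) (auto simp: translate_functional_def scaleR_fun_def fun_eq_iff)
  show "continuous_map pointwise_topology pointwise_topology (translate_functional g)"
    by (simp add: continuous_map_to_pointwise translate_functional_def continuous_map_pointwise_eval)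
  show "translate_functional g ` positive_functionals f \<subseteq> positive_functionals f"
    by (auto simp: positive_functionals_def translate_functional_def left_translate_add
        left_translate_scaleR left_translate_Cb_ru_dominated_iff nonneg_fun_left_translate)
qed (auto simp: translate_functional_def fun_eq_iff left_translate_zero left_translate_left_translate minus_add)

lemma locally_bounded_ruc_translate_functional:
  assumes f: "f \<in> Cb_ru_dominated f" "f \<noteq> 0"
  shows "locally_bounded_ruc pointwise_topology (positive_functionals f) translate_functional"
proof -
  let ?D = "Cb_ru_dominated f"
  \<comment> \<open>The evaluation point is taken where \<open>f\<close> does not vanish, so that
    the functional \<open>x0\<close> is non-zero.\<close>
  obtain p where p: "apply_bcontfun f p \<noteq> 0"
    using f(2) bcontfun_eqI[of f 0] by (auto simp: zero_bcontfun.rep_eq)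
  define x0 where "x0 = (\<lambda>h. if h \<in> ?D then apply_bcontfun h p else 0)"
  have orbit: "translate_functional g x0 h = (if h \<in> ?D then apply_bcontfun h (g + p) else 0)" for g h
    by (simp add: translate_functional_def x0_def left_translate_Cb_ru_dominated_iff)
  have x0C: "x0 \<in> positive_functionals f"
    by (simp add: positive_functionals_def x0_def nonneg_fun_def plus_bcontfun.rep_eq scaleR_bcontfun.rep_eq
        subspace_add[OF subspace_Cb_ru_dominated] subspace_scale[OF subspace_Cb_ru_dominated])
  have "x0 f \<noteq> 0" using f(1) p by (simp add: x0_def)
  then have x0_nz: "x0 \<noteq> 0" by auto
  have bdd: "tvs_bounded pointwise_topology (range (\<lambda>g. translate_functional g x0))"
  proof (rule tvs_bounded_pointwise)
    fix v h assume "v \<in> range (\<lambda>g. translate_functional g x0)"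
    then obtain g where "v = translate_functional g x0" by auto
    then show "\<bar>v h\<bar> \<le> norm h"
      using norm_bounded[of h "g + p"] by (simp add: orbit)
  qed
  have unif: "\<exists>V. open V \<and> 0 \<in> V \<and>
      (\<forall>a\<in>V. \<forall>g. translate_functional (a + g) x0 - translate_functional g x0 \<in> U)"
    if U: "openin pointwise_topology U" "0 \<in> U" for U
  proof -
    obtain F e where F: "finite F" "0 < (e::real)" "{w. \<forall>h\<in>F. \<bar>w h - 0 h\<bar> < e} \<subseteq> U"
      using pointwise_neighbourhood[OF U] .
    have "\<exists>V. open V \<and> 0 \<in> V \<and> (\<forall>a\<in>V. \<forall>x. \<bar>apply_bcontfun h (a + x) - apply_bcontfun h x\<bar> < e)"
      if "h \<in> ?D" for h
      using that F(2) by (simp add: Cb_ru_dominated_iff Cb_ru_iff)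
    then obtain V where V: "\<And>h. h \<in> ?D \<Longrightarrow> open (V h)" "\<And>h. h \<in> ?D \<Longrightarrow> 0 \<in> V h"
      "\<And>h a x. h \<in> ?D \<Longrightarrow> a \<in> V h \<Longrightarrow> \<bar>apply_bcontfun h (a + x) - apply_bcontfun h x\<bar> < e"
      by metis
    \<comment> \<open>A neighbourhood constrains finitely many coordinates, so finitely many moduli
      of continuity are intersected. Coordinates outside \<open>?D\<close> are constantly zero along
      the orbit.\<close>
    define W where "W = (\<Inter>h\<in>F \<inter> ?D. V h)"
    have "open W" "0 \<in> W" using F(1) V(1,2) by (auto simp: W_def)
    moreover have "translate_functional (a + g) x0 - translate_functional g x0 \<in> U" if "a \<in> W" for a g
    proof -
      have "\<bar>(translate_functional (a + g) x0 - translate_functional g x0) h\<bar> < e" if "h \<in> F" for h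
        using that \<open>a \<in> W\<close> V(3)[of h a "g + p"] F(2) by (auto simp: orbit W_def add.assoc)
      then show ?thesis using F(3) by auto
    qed
    ultimately show ?thesis by blast
  qed
  show ?thesis
    unfolding locally_bounded_ruc_def
    by (intro bexI[OF _ x0C] conjI x0_nz bdd allI impI unif) simp_all
qed

text \<open>The adjoint translates of evaluation at \<open>f\<close> are the evaluations at
  translates of \<open>f\<close>. A continuous functional is a finite combination of evaluations,
  and each of these is either bounded on the cone by a majorant of this kind or zero there.\<close>

lemma cobounded_type_translate_functional:
  assumes f: "f \<in> Cb_ru_dominated f"
  shows "cobounded_type pointwise_topology (positive_functionals f) translate_functional"
proof -
  let ?C = "positive_functionals f" and ?a = "\<lambda>g v. v (left_translate g f)"
  have "orbit_dominated ?a ?C \<psi>" if \<psi>: "\<psi> \<in> continuous_dual pointwise_topology" for \<psi>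
  proof -
    obtain F c where F: "finite F" "\<psi> = (\<lambda>v. \<Sum>h\<in>F. c h * v h)"
      by (rule continuous_dual_pointwise[OF \<psi>])
    have "orbit_dominated ?a ?C (\<lambda>v. v h)" for h
    proof (cases "h \<in> Cb_ru_dominated f")
      case True
      obtain n :: nat and g :: "nat \<Rightarrow> 'a"
        where "\<forall>v\<in>?C. \<bar>v h\<bar> \<le> (\<Sum>j=1..n. v (left_translate (g j) f))"
        using Cb_ru_dominated_majorant[OF f True] by metis
      then show ?thesis
        unfolding orbit_dominated_def by (intro exI)
    next
      case False
      then show ?thesis
        using positive_functionalsD(4) by (intro orbit_dominated_mono[OF orbit_dominated_zero]) auto
    qed
    then have "orbit_dominated ?a ?C (\<lambda>v. \<Sum>h\<in>F. c h * v h)"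
      by (intro orbit_dominated_sum F(1) orbit_dominated_scale)
    then show ?thesis by (simp add: F(2))
  qed
  then show ?thesis
    unfolding cobounded_type_def cone_le_def adjoint_rep_def orbit_dominated_def
    by (intro bexI[OF _ eval_in_continuous_dual[of f]])
      (simp add: translate_functional_def abs_le_iff ball_conj_distrib)
qed

theorem integral_if_fixed_point:
  assumes fix_prop: "fixed_point_property_for_cones TYPE('g::topological_group_add) TYPE(('g \<Rightarrow>\<^sub>C real) \<Rightarrow> real)"
  shows "invariant_normalized_integral_property TYPE('g)"
  unfolding invariant_normalized_integral_property_def
proof (intro allI impI, elim conjE)
  fix f :: "'g \<Rightarrow>\<^sub>C real" assume f: "f \<in> Cb_ru" "f \<noteq> 0" "nonneg_fun f"
  let ?D = "Cb_ru_dominated f"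
  have "\<bar>apply_bcontfun f x\<bar> \<le> (\<Sum>j=1..1::nat. apply_bcontfun (left_translate 0 f) x)" for x
    using f(3) by (simp add: nonneg_fun_def)
  then have fD: "f \<in> ?D"
    using f(1) unfolding Cb_ru_dominated_def
    by (intro CollectI conjI exI[of _ 1] exI[of _ "\<lambda>_. 0"] allI)
  obtain v where v: "v \<in> positive_functionals f" "v \<noteq> 0" "\<And>g. translate_functional g v = v"
    using fix_prop[unfolded fixed_point_property_for_cones_def, rule_format, OF conjI,
        OF locally_convex_pointwise conjI, OF proper_cone_positive_functionals[OF fD] conjI,
        OF weakly_complete_positive_functionals conjI,
        OF cone_representation_translate_functional conjI,
        OF locally_bounded_ruc_translate_functional[OF fD f(2)] cobounded_type_translate_functional[OF fD]]
    by blast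
  have inv: "v (left_translate g h) = v h" for g h
    using fun_cong[OF v(3)[of "- g"], of h] by (simp add: translate_functional_def)
  \<comment> \<open>Invariance gives all translates of \<open>f\<close> the value
    \<open>v f\<close>; were it 0, the majorants would force \<open>v\<close> to vanish.\<close>
  have "v f \<noteq> 0"
  proof
    assume zero: "v f = 0"
    have "v h = 0" for h
    proof (cases "h \<in> ?D")
      case True
      obtain n :: nat and g where "\<bar>v h\<bar> \<le> (\<Sum>j=1..n. v (left_translate (g j) f))"
        using Cb_ru_dominated_majorant[OF fD True] v(1) by metis
      then show ?thesis by (simp add: inv zero)
    qed (rule positive_functionalsD(4)[OF v(1)])
    then show False using v(2) by (auto simp: fun_eq_iff)
  qed
  then have pos: "v f > 0"
    using positive_functionalsD(3)[OF v(1) fD f(3)] by simp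
  have "invariant_normalized_integral f (\<lambda>h. v h / v f)"
    unfolding invariant_normalized_integral_def
    using pos positive_functionalsD[OF v(1)] by (auto simp: inv add_divide_distrib)
  then show "\<exists>I. invariant_normalized_integral f I" by blast
qed

text \<open>The quantification over all vector spaces is split in two: the fixed-point property on
  the one type \<open>('g \<Rightarrow>\<^sub>C real) \<Rightarrow> real\<close> already yields the
  integrals, while the integrals yield the fixed-point property on an arbitrary type
  \<open>'e\<close>.\<close>

theorem theorem3:
  shows "(fixed_point_property_for_cones TYPE('g::topological_group_add) TYPE(('g \<Rightarrow>\<^sub>C real) \<Rightarrow> real)
            \<longleftrightarrow> invariant_normalized_integral_property TYPE('g)) \<and>
         (invariant_normalized_integral_property TYPE('g)
            \<longrightarrow> fixed_point_property_for_cones TYPE('g) TYPE('e::real_vector))"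
  using integral_if_fixed_point[where 'g = 'g] fixed_point_if_integral[where 'g = 'g and 'e = 'e]
    fixed_point_if_integral[where 'g = 'g and 'e = "('g \<Rightarrow>\<^sub>C real) \<Rightarrow> real"]
  by blast

end
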